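(* Let $\phi_{2,h}\in\mathbb B^*_{\mathbf\Xi_2,p}$ and let the overlap width satisfy $d_o\le C\,h^\lambda$ with $C>0$, $\lambda\ge1$. There is a constant $c>0$, depending on $\rho$ but independent of $u$ and $\Omega_{o21}$, such that $$\|\phi_{2,h}\|^2_{L^2(\Omega_{o21})}\le c\,d_o\,h\Big(\int_{\Omega_2^*}|\nabla\phi_{2,h}|^2\,dx+\frac{\{\rho\}}{h}\int_{F_{o21}}\phi_{2,h}^2\,d\sigma\Big).$$
   Context: $\Omega\subset\mathbb R^d$, $d\in\{2,3\}$, is a bounded Lipschitz domain, $\overline\Omega=\overline{\Omega_1}\cup\overline{\Omega_2}$ with disjoint open subdomains $\Omega_1,\Omega_2$, interface $F_{12}=\partial\Omega_1\cap\partial\Omega_2$; the coefficient $\rho$ equals a constant $\rho_i>0$ on $\Omega_i$, and $\{\rho\}=\frac12(\rho_1+\rho_2)$. $u$ denotes the weak solution of $-\mathrm{div}(\rho\nabla u)=f$ in $\Omega$, $u=0$ on $\partial\Omega$. Overlapping patches: $\overline\Omega=\overline{\Omega_1^*}\cup\overline{\Omega_2^*}$ with $\Omega_{o21}=\Omega_1^*\cap\Omega_2^*\subset\Omega$, $F_{o12}=\partial\Omega_1^*\cap\Omega_2^*$, $F_{o21}=\partial\Omega_2^*\cap\Omega_1^*$, $\partial\Omega_{o21}=F_{o12}\cup F_{o21}$. Assumptions: $\Omega_1^*=\Omega_1$; $F_{o12}=F_{12}$ is a planar face with unit normal $n_{F_{o12}}$ exterior to $\Omega_1^*$; $F_{o21}$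 is a graph $z=\zeta_o(x,y)$, $0\le x\le x_M$, $0\le y\le y_M$, of a smooth function over $F_{o12}$ (analogously in 2d). With $\mathbf\Phi_{o12}:F_{o12}\to F_{o21}$, $\mathbf\Phi_{o12}(x)=x+\zeta_o(x)n_{F_{o12}}$ ($\zeta_o$ real-valued), the width is $d_o=\max_{x\in F_{o12}}|x-\mathbf\Phi_{o12}(x)|$. B-splines: $\hat{\mathbb B}_{\mathbf\Xi_2,p}$ is the tensor-product B-spline space of degree $p$ on $\widehat\Omega=(0,1)^d$ with open knot vectors $\mathbf\Xi_2$ (interior multiplicities at most $p$); $\mathbf\Phi_2^*:\widehat\Omega\to\Omega_2^*$ is a B-spline parametrization, sufficiently smooth, with $|\det J_{\mathbf\Phi_2^*}|$ bounded above and below by positive constants; $\mathbb B^*_{\mathbf\Xi_2,p}=\mathrm{span}\{\hat B_j\circ(\mathbf\Phi_2^* )^{-1}\}$. $h$ is the mesh size (maximum over the patches of the largest element diameter of the parametric meshes induced by the knots). *)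

theory Defs
  imports "HOL-Analysis.Analysis"
begin

subsection \<open>Domains\<close>

definition lipschitz_domain :: "(real^'n) set \<Rightarrow> bool" where
  "lipschitz_domain \<Omega> \<longleftrightarrow>
     \<Omega> \<noteq> {} \<and> open \<Omega> \<and> connected \<Omega> \<and> bounded \<Omega> \<and>
     (\<forall>x\<in>frontier \<Omega>. \<exists>r>0. \<exists>\<nu> L \<gamma>. norm \<nu> = 1 \<and> L-lipschitz_on {z. z \<bullet> \<nu> = 0} \<gamma> \<and>
        \<Omega> \<inter> ball x r = {y \<in> ball x r. y \<bullet> \<nu> < \<gamma> (y - (y \<bullet> \<nu>) *\<^sub>R \<nu>)})"

definition subdomain_decomposition ::
  "(real^'n) set \<Rightarrow> (real^'n) set \<Rightarrow> (real^'n) set \<Rightarrow> bool" where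
  "subdomain_decomposition \<Omega> \<Omega>\<^sub>1 \<Omega>\<^sub>2 \<longleftrightarrow>
     (\<forall>D\<in>{\<Omega>\<^sub>1, \<Omega>\<^sub>2}. D \<noteq> {} \<and> open D \<and> connected D \<and> D \<subseteq> \<Omega>) \<and>
     \<Omega>\<^sub>1 \<inter> \<Omega>\<^sub>2 = {} \<and> closure \<Omega> = closure \<Omega>\<^sub>1 \<union> closure \<Omega>\<^sub>2"

definition interface :: "(real^'n) set \<Rightarrow> (real^'n) set \<Rightarrow> (real^'n) set" where
  "interface \<Omega>\<^sub>1 \<Omega>\<^sub>2 = frontier \<Omega>\<^sub>1 \<inter> frontier \<Omega>\<^sub>2"

text \<open>
  \<open>overlap_face A B\<close> is the part of the boundary of patch \<open>A\<close> inside patch \<open>B\<close>. As \<open>B\<close> is open, it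
  misses the edges where the boundaries of both patches meet, hence the closures in the boundary
  decomposition of the overlap.
\<close>

definition overlap_face :: "(real^'n) set \<Rightarrow> (real^'n) set \<Rightarrow> (real^'n) set" where
  "overlap_face A B = frontier A \<inter> B"

definition overlapping_patches ::
  "(real^'n) set \<Rightarrow> (real^'n) set \<Rightarrow> (real^'n) set \<Rightarrow> bool" where
  "overlapping_patches \<Omega> P\<^sub>1 P\<^sub>2 \<longleftrightarrow>
     open P\<^sub>1 \<and> open P\<^sub>2 \<and> closure \<Omega> = closure P\<^sub>1 \<union> closure P\<^sub>2 \<and> P\<^sub>1 \<inter> P\<^sub>2 \<subseteq> \<Omega> \<and>
     frontier (P\<^sub>1 \<inter> P\<^sub>2) = closure (overlap_face P\<^sub>1 P\<^sub>2) \<union> closure (overlap_face P\<^sub>2 P\<^sub>1)"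


subsection \<open>Planar face, graph over the face, surface integral\<close>

text \<open>
  Local coordinates on a planar face in \<open>\<real>\<^sup>d\<close>: \<open>s \<in> \<real>\<^sup>d\<^sup>-\<^sup>1\<close> stands for the point \<open>a + E s\<close>, where
  \<open>E\<close> is a linear isometry, and the last coordinate is measured along the unit normal \<open>n\<close>. The
  parameter range is the rectangle \<open>cbox 0 m\<close> (for \<open>d = 3\<close>: \<open>m = (x\<^sub>M, y\<^sub>M)\<close>).
\<close>

definition face :: "real^'n \<Rightarrow> (real^'m \<Rightarrow> real^'n) \<Rightarrow> real^'m \<Rightarrow> (real^'n) set" where
  "face a E m = (\<lambda>s. a + E s) ` cbox 0 m"

definition planar_frame :: "(real^'m \<Rightarrow> real^'n) \<Rightarrow> real^'m \<Rightarrow> real^'n \<Rightarrow> bool" where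
  "planar_frame E m n \<longleftrightarrow>
     linear E \<and> (\<forall>s. norm (E s) = norm s) \<and> (\<forall>i. 0 < m $ i) \<and>
     norm n = 1 \<and> (\<forall>s. n \<bullet> E s = 0)"

definition exterior_direction :: "(real^'n) set \<Rightarrow> (real^'n) set \<Rightarrow> real^'n \<Rightarrow> bool" where
  "exterior_direction D F n \<longleftrightarrow>
     (\<forall>x\<in>rel_interior F. \<exists>\<epsilon>>0. \<forall>t. 0 < t \<and> t < \<epsilon> \<longrightarrow>
        x - t *\<^sub>R n \<in> D \<and> x + t *\<^sub>R n \<notin> closure D)"

definition graph_map ::
  "real^'n \<Rightarrow> (real^'m \<Rightarrow> real^'n) \<Rightarrow> real^'n \<Rightarrow> (real^'m \<Rightarrow> real) \<Rightarrow> real^'m \<Rightarrow> real^'n" where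
  "graph_map a E n \<zeta> s = a + E s + \<zeta> s *\<^sub>R n"

definition overlap_width ::
  "real^'n \<Rightarrow> (real^'m \<Rightarrow> real^'n) \<Rightarrow> real^'m \<Rightarrow> real^'n \<Rightarrow> (real^'m \<Rightarrow> real) \<Rightarrow> real" where
  "overlap_width a E m n \<zeta> = (SUP s\<in>cbox 0 m. norm ((a + E s) - graph_map a E n \<zeta> s))"

text \<open>Only continuous differentiability up to the boundary of the rectangle is required of \<open>\<zeta>\<close>.\<close>

definition C1_rectangle :: "real^'m \<Rightarrow> (real^'m \<Rightarrow> real) \<Rightarrow> bool" where
  "C1_rectangle m \<zeta> \<longleftrightarrow>
     (\<exists>G. continuous_on (cbox 0 m) G \<and>
        (\<forall>s\<in>cbox 0 m. (\<zeta> has_derivative (\<lambda>v. G s \<bullet> v)) (at s within cbox 0 m)))"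

text \<open>
  Meaningful where \<open>f\<close> is differentiable. All gradients below are integrated over sets on which this
  is the case almost everywhere (mapped splines, which are continuous and piecewise smooth, and
  \<open>C\<^sup>1\<close> functions on a rectangle).
\<close>

definition grad :: "(real^'n \<Rightarrow> real) \<Rightarrow> real^'n \<Rightarrow> real^'n" where
  "grad f x = (THE D. GDERIV f x :> D)"

text \<open>
  Integral of \<open>g\<close> over the part \<open>F\<close> of the graph of \<open>\<zeta>\<close>, with respect to the surface element
  \<open>d\<sigma> = sqrt (1 + \<bar>\<nabla>\<zeta>\<bar>\<^sup>2) ds\<close>.
\<close>

definition graph_surface_integral ::
  "real^'n \<Rightarrow> (real^'m \<Rightarrow> real^'n) \<Rightarrow> real^'m \<Rightarrow> real^'n \<Rightarrow> (real^'m \<Rightarrow> real) \<Rightarrow>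
   (real^'n) set \<Rightarrow> (real^'n \<Rightarrow> real) \<Rightarrow> real" where
  "graph_surface_integral a E m n \<zeta> F g =
     (LINT s : {s \<in> cbox 0 m. graph_map a E n \<zeta> s \<in> F} | lebesgue.
        g (graph_map a E n \<zeta> s) * sqrt (1 + (norm (grad \<zeta> s))\<^sup>2))"

definition L2_norm :: "(real^'n) set \<Rightarrow> (real^'n \<Rightarrow> real) \<Rightarrow> real" where
  "L2_norm S f = sqrt (LINT x : S | lebesgue. (f x)\<^sup>2)"

text \<open>Values on the boundary of the open set \<open>S\<close> of a function given in \<open>S\<close>.\<close>

definition boundary_trace :: "(real^'n) set \<Rightarrow> (real^'n \<Rightarrow> real) \<Rightarrow> real^'n \<Rightarrow> real" where
  "boundary_trace S f x = Lim (at x within S) f"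


subsection \<open>B-splines\<close>

definition open_knot_vector :: "nat \<Rightarrow> real list \<Rightarrow> bool" where
  "open_knot_vector p \<xi> \<longleftrightarrow>
     sorted \<xi> \<and> set \<xi> \<subseteq> {0..1} \<and> count_list \<xi> 0 = p + 1 \<and> count_list \<xi> 1 = p + 1 \<and>
     (\<forall>x. 0 < x \<and> x < 1 \<longrightarrow> count_list \<xi> x \<le> p)"

text \<open>
  Cox--de Boor recursion. The convention that a quotient with zero denominator is \<open>0\<close> is the one
  of \<open>x / 0 = 0\<close> in HOL. Only values at \<open>x \<in> (0,1)\<close> are used, so the right endpoint needs no care.
\<close>

fun bspline :: "real list \<Rightarrow> nat \<Rightarrow> nat \<Rightarrow> real \<Rightarrow> real" where
  "bspline \<xi> 0 j x = (if \<xi> ! j \<le> x \<and> x < \<xi> ! (j + 1) then 1 else 0)"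
| "bspline \<xi> (Suc p) j x =
     (x - \<xi> ! j) / (\<xi> ! (j + p + 1) - \<xi> ! j) * bspline \<xi> p j x +
     (\<xi> ! (j + p + 2) - x) / (\<xi> ! (j + p + 2) - \<xi> ! (j + 1)) * bspline \<xi> p (j + 1) x"

definition tensor_bspline :: "('n \<Rightarrow> real list) \<Rightarrow> nat \<Rightarrow> ('n \<Rightarrow> nat) \<Rightarrow> real^'n \<Rightarrow> real" where
  "tensor_bspline \<Xi> p j x = (\<Prod>i\<in>UNIV. bspline (\<Xi> i) p (j i) (x $ i))"

definition bspline_indices :: "('n \<Rightarrow> real list) \<Rightarrow> nat \<Rightarrow> ('n \<Rightarrow> nat) set" where
  "bspline_indices \<Xi> p = {j. \<forall>i. j i < length (\<Xi> i) - p - 1}"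

definition bspline_space :: "('n::finite \<Rightarrow> real list) \<Rightarrow> nat \<Rightarrow> (real^'n \<Rightarrow> real) set" where
  "bspline_space \<Xi> p = {f. \<exists>c. f = (\<lambda>x. \<Sum>j\<in>bspline_indices \<Xi> p. c j * tensor_bspline \<Xi> p j x)}"

abbreviation param_domain :: "(real^'n) set" where
  "param_domain \<equiv> box 0 1"

abbreviation jacobian :: "(real^'n \<Rightarrow> real^'n) \<Rightarrow> real^'n \<Rightarrow> real^'n^'n" where
  "jacobian \<Phi> x \<equiv> matrix (frechet_derivative \<Phi> (at x))"

text \<open>
  The B-splines describing the geometry may use knots and a degree of their own, for instance
  those of a coarser initial mesh.
\<close>

definition bspline_parametrization :: "(real^'n \<Rightarrow> real^'n) \<Rightarrow> (real^'n) set \<Rightarrow> bool" where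
  "bspline_parametrization \<Phi> P \<longleftrightarrow>
     bij_betw \<Phi> param_domain P \<and>
     (\<exists>\<Xi> q. (\<forall>i. open_knot_vector q (\<Xi> i)) \<and>
        (\<forall>i. \<exists>f\<in>bspline_space \<Xi> q. \<forall>x\<in>param_domain. \<Phi> x $ i = f x)) \<and>
     (\<forall>x\<in>param_domain. \<Phi> differentiable at x) \<and>
     continuous_on param_domain (jacobian \<Phi>) \<and>
     (\<exists>b B. 0 < b \<and>
        (\<forall>x\<in>param_domain. b \<le> \<bar>det (jacobian \<Phi> x)\<bar> \<and> \<bar>det (jacobian \<Phi> x)\<bar> \<le> B))"

definition mapped_bspline_space ::
  "('n::finite \<Rightarrow> real list) \<Rightarrow> nat \<Rightarrow> (real^'n \<Rightarrow> real^'n) \<Rightarrow> (real^'n \<Rightarrow> real) set" where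
  "mapped_bspline_space \<Xi> p \<Phi> = (\<lambda>f. f \<circ> inv_into param_domain \<Phi>) ` bspline_space \<Xi> p"

definition mesh_elements :: "('n::finite \<Rightarrow> real list) \<Rightarrow> (real^'n) set set" where
  "mesh_elements \<Xi> = {cbox u v | u v. \<forall>i. u $ i < v $ i \<and> u $ i \<in> set (\<Xi> i) \<and>
     v $ i \<in> set (\<Xi> i) \<and> set (\<Xi> i) \<inter> {u $ i<..<v $ i} = {}}"

definition mesh_size :: "('n::finite \<Rightarrow> real list) \<Rightarrow> ('n \<Rightarrow> real list) \<Rightarrow> real" where
  "mesh_size \<Xi>\<^sub>1 \<Xi>\<^sub>2 =
     max (Max (diameter ` mesh_elements \<Xi>\<^sub>1)) (Max (diameter ` mesh_elements \<Xi>\<^sub>2))"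


subsection \<open>Admissible overlap\<close>

text \<open>
  \<open>\<Omega>\<^sub>1 = P\<^sub>1\<close>, and the faces \<open>overlap_face P\<^sub>1 P\<^sub>2\<close> and \<open>overlap_face P\<^sub>2 P\<^sub>1\<close> are the planar face and
  the graph of \<open>\<zeta>\<close> over it, both up to their relative boundaries. Exact equality is impossible: the
  interface is closed and reaches the boundary of the domain, while the patches are open.
\<close>

definition graph_overlap ::
  "(real^'n) set \<Rightarrow> (real^'n) set \<Rightarrow> real^'n \<Rightarrow> (real^'m \<Rightarrow> real^'n) \<Rightarrow> real^'m \<Rightarrow> real^'n \<Rightarrow>
   (real^'n) set \<Rightarrow> (real^'n) set \<Rightarrow> (real^'m \<Rightarrow> real) \<Rightarrow> bool" where
  "graph_overlap \<Omega> \<Omega>\<^sub>1 a E m n P\<^sub>1 P\<^sub>2 \<zeta> \<longleftrightarrow>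
     overlapping_patches \<Omega> P\<^sub>1 P\<^sub>2 \<and> P\<^sub>1 = \<Omega>\<^sub>1 \<and>
     rel_interior (face a E m) \<subseteq> overlap_face P\<^sub>1 P\<^sub>2 \<and> overlap_face P\<^sub>1 P\<^sub>2 \<subseteq> face a E m \<and>
     C1_rectangle m \<zeta> \<and>
     graph_map a E n \<zeta> ` box 0 m \<subseteq> overlap_face P\<^sub>2 P\<^sub>1 \<and>
     overlap_face P\<^sub>2 P\<^sub>1 \<subseteq> graph_map a E n \<zeta> ` cbox 0 m"

end

theory Submission
  imports Defs
begin

text \<open>
  In the coordinates \<open>(s, t) \<mapsto> a + E s + t n\<close> the overlap is a bounded open set whose frontier lies on
  the face \<open>t = 0\<close> and the graph \<open>t = \<zeta> s\<close>, hence it is the set of points strictly between the two.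
  A mapped spline is Lipschitz along segments inside the patch and differentiable almost everywhere,
  so it has a trace on the graph, and along almost every vertical line the fundamental theorem of
  calculus and the Cauchy--Schwarz inequality bound \<open>\<phi>\<^sup>2\<close> by twice the squared trace plus
  \<open>2 \<bar>\<zeta> s\<bar>\<close> times the integral of \<open>(\<partial>\<^sub>n \<phi>)\<^sup>2\<close> over that line. Integrating over the overlap
  gives \<open>2 d\<^sub>o\<close> times the trace term plus \<open>2 d\<^sub>o\<^sup>2\<close> times the gradient term, and \<open>d\<^sub>o \<le> K h\<close>
  because \<open>\<lambda> \<ge> 1\<close> and \<open>h\<close> is at most the diameter of the unit cube.
\<close>

subsection \<open>Lipschitz continuity of B-splines\<close>

text \<open>
  The left-continuous variant of a B-spline. The two differ at \<open>z\<close> only if the first or the last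
  \<open>p + 1\<close> of the \<open>p + 2\<close> knots involved equal \<open>z\<close>; this yields continuity across knots of
  multiplicity at most \<open>p\<close>.
\<close>

fun bspline_left :: "real list \<Rightarrow> nat \<Rightarrow> nat \<Rightarrow> real \<Rightarrow> real" where
  "bspline_left \<xi> 0 j x = (if \<xi> ! j < x \<and> x \<le> \<xi> ! (j + 1) then 1 else 0)"
| "bspline_left \<xi> (Suc p) j x =
     (x - \<xi> ! j) / (\<xi> ! (j + p + 1) - \<xi> ! j) * bspline_left \<xi> p j x +
     (\<xi> ! (j + p + 2) - x) / (\<xi> ! (j + p + 2) - \<xi> ! (j + 1)) * bspline_left \<xi> p (j + 1) x"

lemma bspline_minus_bspline_left:
  assumes "sorted \<xi>" "j + p + 1 < length \<xi>"
  shows "bspline \<xi> p j z - bspline_left \<xi> p j z =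
    of_bool (\<xi> ! j = z \<and> \<xi> ! (j + p) = z) - of_bool (\<xi> ! (j + 1) = z \<and> \<xi> ! (j + p + 1) = z)"
  using assms(2)
proof (induction p arbitrary: j)
  case 0
  have "\<xi> ! j \<le> \<xi> ! (j + 1)" using assms(1) 0 by (intro sorted_nth_mono) auto
  then show ?case by auto
next
  case (Suc p)
  define w1 where "w1 = (z - \<xi> ! j) / (\<xi> ! (j + p + 1) - \<xi> ! j)"
  define w2 where "w2 = (\<xi> ! (j + p + 2) - z) / (\<xi> ! (j + p + 2) - \<xi> ! (j + 1))"
  have le: "\<xi> ! j \<le> \<xi> ! (j + 1)" "\<xi> ! (j + 1) \<le> \<xi> ! (j + p + 1)" "\<xi> ! j \<le> \<xi> ! (j + p)"
      "\<xi> ! (j + p) \<le> \<xi> ! (j + p + 1)" "\<xi> ! (j + p + 1) \<le> \<xi> ! (j + p + 2)"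
      "\<xi> ! (j + 1) \<le> \<xi> ! (j + 2)" "\<xi> ! (j + 2) \<le> \<xi> ! (j + p + 2)"
    using assms(1) Suc.prems by (auto intro!: sorted_nth_mono)
  have i1: "bspline \<xi> p j z - bspline_left \<xi> p j z =
    of_bool (\<xi> ! j = z \<and> \<xi> ! (j + p) = z) - of_bool (\<xi> ! (j + 1) = z \<and> \<xi> ! (j + p + 1) = z)"
    using Suc.IH[of j] Suc.prems by simp
  have i2: "bspline \<xi> p (j + 1) z - bspline_left \<xi> p (j + 1) z =
    of_bool (\<xi> ! (j + 1) = z \<and> \<xi> ! (j + p + 1) = z) - of_bool (\<xi> ! (j + 2) = z \<and> \<xi> ! (j + p + 2) = z)"
    using Suc.IH[of "j + 1"] Suc.prems by (simp add: algebra_simps)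
  have "bspline \<xi> (Suc p) j z - bspline_left \<xi> (Suc p) j z =
     w1 * (bspline \<xi> p j z - bspline_left \<xi> p j z) +
     w2 * (bspline \<xi> p (j + 1) z - bspline_left \<xi> p (j + 1) z)"
    unfolding bspline.simps bspline_left.simps w1_def[symmetric] w2_def[symmetric]
    by (simp add: right_diff_distrib)
  also have "w1 * (bspline \<xi> p j z - bspline_left \<xi> p j z) =
     - of_bool (\<xi> ! j \<noteq> z \<and> \<xi> ! (j + 1) = z \<and> \<xi> ! (j + p + 1) = z)"
    unfolding i1 using le by (auto simp: w1_def divide_simps)
  also have "w2 * (bspline \<xi> p (j + 1) z - bspline_left \<xi> p (j + 1) z) =
     of_bool (\<xi> ! (j + p + 2) \<noteq> z \<and> \<xi> ! (j + 1) = z \<and> \<xi> ! (j + p + 1) = z)"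
    unfolding i2 using le by (auto simp: w2_def divide_simps)
  also have "- of_bool (\<xi> ! j \<noteq> z \<and> \<xi> ! (j + 1) = z \<and> \<xi> ! (j + p + 1) = z) +
     of_bool (\<xi> ! (j + p + 2) \<noteq> z \<and> \<xi> ! (j + 1) = z \<and> \<xi> ! (j + p + 1) = z) =
     (of_bool (\<xi> ! j = z \<and> \<xi> ! (j + Suc p) = z) -
      of_bool (\<xi> ! (j + 1) = z \<and> \<xi> ! (j + Suc p + 1) = z) :: real)"
    using le by auto
  finally show ?case .
qed

lemma bspline_eq_bspline_left:
  assumes "open_knot_vector p \<xi>" "j + p + 1 < length \<xi>" "0 < z" "z < 1"
  shows "bspline \<xi> p j z = bspline_left \<xi> p j z"
proof -
  have s: "sorted \<xi>" and c: "count_list \<xi> z \<le> p"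
    using assms by (auto simp: open_knot_vector_def)
  have "\<not> (\<xi> ! i = z \<and> \<xi> ! (i + p) = z)" if "i + p < length \<xi>" for i
  proof
    assume z: "\<xi> ! i = z \<and> \<xi> ! (i + p) = z"
    have "\<xi> ! k = z" if "k \<in> {i..i + p}" for k
      using sorted_nth_mono[OF s, of i k] sorted_nth_mono[OF s, of k "i + p"] z that \<open>i + p < length \<xi>\<close>
      by auto
    then have "{i..i + p} \<subseteq> {k. k < length \<xi> \<and> z = \<xi> ! k}"
      using that by auto
    then have "card {i..i + p} \<le> card {k. k < length \<xi> \<and> z = \<xi> ! k}"
      by (intro card_mono) auto
    also have "\<dots> = count_list \<xi> z"
      by (simp add: count_list_eq_length_filter length_filter_conv_card)
    finally show False using c by simp
  qed
  from this[of j] this[of "j + 1"] assms(2)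
  have "(\<xi> ! j = z \<and> \<xi> ! (j + p) = z) = False" "(\<xi> ! (j + 1) = z \<and> \<xi> ! (j + p + 1) = z) = False"
    by (auto simp: add.commute add.left_commute)
  then show ?thesis
    using bspline_minus_bspline_left[OF s assms(2), of z] by (simp only: of_bool_eq diff_self right_minus_eq)
qed

lemma bspline_poly_on_span:
  assumes "j + p + 1 < length \<xi>" "u < v" "set \<xi> \<inter> {u<..<v} = {}"
  obtains P where "\<And>x. x \<in> {u..<v} \<Longrightarrow> bspline \<xi> p j x = poly P x"
    "\<And>x. x \<in> {u<..v} \<Longrightarrow> bspline_left \<xi> p j x = poly P x"
proof -
  have "\<exists>P. (\<forall>x\<in>{u..<v}. bspline \<xi> p j x = poly P x) \<and> (\<forall>x\<in>{u<..v}. bspline_left \<xi> p j x = poly P x)"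
    using assms(1)
  proof (induction p arbitrary: j)
    case 0
    have "\<xi> ! j \<in> set \<xi>" "\<xi> ! (j + 1) \<in> set \<xi>" using 0 by auto
    then have *: "\<xi> ! j \<le> u \<or> v \<le> \<xi> ! j" "\<xi> ! (j + 1) \<le> u \<or> v \<le> \<xi> ! (j + 1)"
      using assms(3) by (meson disjoint_iff greaterThanLessThan_iff not_le)+
    show ?case
      by (rule exI[of _ "if \<xi> ! j \<le> u \<and> v \<le> \<xi> ! (j + 1) then 1 else 0"]) (use * assms(2) in auto)
  next
    case (Suc p)
    obtain P Q where
      "\<forall>x\<in>{u..<v}. bspline \<xi> p j x = poly P x" "\<forall>x\<in>{u<..v}. bspline_left \<xi> p j x = poly P x"
      "\<forall>x\<in>{u..<v}. bspline \<xi> p (j + 1) x = poly Q x" "\<forall>x\<in>{u<..v}. bspline_left \<xi> p (j + 1) x = poly Q x"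
      using Suc.IH[of j] Suc.IH[of "j + 1"] Suc.prems by auto
    then show ?case
      by (intro exI[of _ "smult (1 / (\<xi> ! (j + p + 1) - \<xi> ! j)) ([:- \<xi> ! j, 1:] * P) +
           smult (1 / (\<xi> ! (j + p + 2) - \<xi> ! (j + 1))) ([:\<xi> ! (j + p + 2), -1:] * Q)"])
        (auto simp: diff_divide_distrib add_divide_distrib algebra_simps)
  qed
  then show ?thesis using that by blast
qed

lemma poly_lipschitz_on:
  fixes P :: "real poly"
  shows "\<exists>L. L-lipschitz_on {u..v} (poly P)"
proof -
  have "bounded (poly (pderiv P) ` {u..v})"
    by (intro compact_imp_bounded compact_continuous_image continuous_intros) auto
  then obtain L where L: "L > 0" "\<And>x. x \<in> {u..v} \<Longrightarrow> norm (poly (pderiv P) x) \<le> L"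
    by (auto simp: bounded_pos)
  have "L-lipschitz_on {u..v} (poly P)"
  proof (rule bounded_derivative_imp_lipschitz)
    show "(poly P has_derivative (*) (poly (pderiv P) x)) (at x within {u..v})" for x
      using poly_DERIV[of P x] has_derivative_at_withinI
      by (auto simp: has_field_derivative_def)
    show "onorm ((*) (poly (pderiv P) x)) \<le> L" if "x \<in> {u..v}" for x
      using L(2)[OF that] by (intro onorm_le) (auto simp: abs_mult mult_right_mono)
  qed (use L in auto)
  then show ?thesis ..
qed

lemma bspline_lipschitz:
  assumes "open_knot_vector p \<xi>" "j + p + 1 < length \<xi>"
  shows "\<exists>L. L-lipschitz_on {0<..<1} (bspline \<xi> p j)"
proof -
  define I where "I = {(u, v). u \<in> set \<xi> \<and> v \<in> set \<xi> \<and> u < v \<and> set \<xi> \<inter> {u<..<v} = {}}"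
  have finI: "finite I" by (rule finite_subset[of _ "set \<xi> \<times> set \<xi>"]) (auto simp: I_def)
  have knots: "0 \<in> set \<xi>" "1 \<in> set \<xi>"
    using assms(1) count_notin[of 0 \<xi>] count_notin[of 1 \<xi>] by (auto simp: open_knot_vector_def)
  have "\<exists>M. M-lipschitz_on ({fst i..snd i} \<inter> {0<..<1}) (bspline \<xi> p j)" if "i \<in> I" for i
  proof -
    define u v where "u = fst i" and "v = snd i"
    then have i: "i = (u, v)" "u < v" "set \<xi> \<inter> {u<..<v} = {}"
      using that by (auto simp: I_def)
    obtain P where P: "\<And>x. x \<in> {u..<v} \<Longrightarrow> bspline \<xi> p j x = poly P x"
      "\<And>x. x \<in> {u<..v} \<Longrightarrow> bspline_left \<xi> p j x = poly P x"
      using bspline_poly_on_span[OF assms(2) i(2,3)] by metis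
    obtain L where "L-lipschitz_on {u..v} (poly P)" using poly_lipschitz_on by blast
    then have "L-lipschitz_on ({u..v} \<inter> {0<..<1}) (poly P)"
      by (rule lipschitz_on_subset) auto
    moreover have "bspline \<xi> p j x = poly P x" if "x \<in> {u..v} \<inter> {0<..<1}" for x
      using P[of x] bspline_eq_bspline_left[OF assms, of x] that i by (cases "x < v") auto
    ultimately have "L-lipschitz_on ({u..v} \<inter> {0<..<1}) (bspline \<xi> p j)"
      by (rule lipschitz_on_transform)
    then show ?thesis unfolding i by auto
  qed
  then obtain M where M: "\<And>i. i \<in> I \<Longrightarrow> (M i)-lipschitz_on ({fst i..snd i} \<inter> {0<..<1}) (bspline \<xi> p j)"
    by metis
  have M0: "M i \<ge> 0" if "i \<in> I" for i using lipschitz_on_nonneg[OF M[OF that]] .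
  have "(\<Sum>i\<in>I. M i)-lipschitz_on {x..y} (bspline \<xi> p j)" if "0 < x" "y < 1" for x y
  proof (rule lipschitz_on_closed_Union[where U = "\<lambda>i. {fst i..snd i} \<inter> {x..y}" and I = I])
    show "(\<Sum>i\<in>I. M i)-lipschitz_on ({fst i..snd i} \<inter> {x..y}) (bspline \<xi> p j)" if "i \<in> I" for i
      by (rule lipschitz_on_mono[OF M[OF that]])
        (use \<open>0 < x\<close> \<open>y < 1\<close> M0 finI that in \<open>auto intro: member_le_sum\<close>)
    show "{x..y} \<subseteq> (\<Union>i\<in>I. {fst i..snd i} \<inter> {x..y})"
    proof
      fix z assume z: "z \<in> {x..y}"
      define u where "u = Max {k \<in> set \<xi>. k \<le> z}"
      define v where "v = Min {k \<in> set \<xi>. z < k}"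
      have ne: "{k \<in> set \<xi>. k \<le> z} \<noteq> {}" "{k \<in> set \<xi>. z < k} \<noteq> {}"
        using knots z that by force+
      have uv: "u \<in> {k \<in> set \<xi>. k \<le> z}" "v \<in> {k \<in> set \<xi>. z < k}"
        unfolding u_def v_def using ne by (intro Max_in Min_in; auto)+
      have "k \<le> u \<or> v \<le> k" if "k \<in> set \<xi>" for k
        unfolding u_def v_def using that by (cases "k \<le> z") auto
      then have "(u, v) \<in> I" using uv by (force simp: I_def)
      then show "z \<in> (\<Union>i\<in>I. {fst i..snd i} \<inter> {x..y})" using uv z by force
    qed
  qed (use finI M0 in \<open>auto intro: sum_nonneg closed_Int\<close>)
  then have *: "dist (bspline \<xi> p j x) (bspline \<xi> p j y) \<le> (\<Sum>i\<in>I. M i) * dist x y"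
    if "0 < x" "x \<le> y" "y < 1" for x y
    using that lipschitz_onD[of "\<Sum>i\<in>I. M i" "{x..y}" "bspline \<xi> p j" x y] by auto
  have "(\<Sum>i\<in>I. M i)-lipschitz_on {0<..<1} (bspline \<xi> p j)"
  proof (rule lipschitz_onI)
    fix x y :: real assume "x \<in> {0<..<1}" "y \<in> {0<..<1}"
    then show "dist (bspline \<xi> p j x) (bspline \<xi> p j y) \<le> (\<Sum>i\<in>I. M i) * dist x y"
      using *[of x y] *[of y x] by (cases "x \<le> y") (simp_all add: dist_commute)
  qed (use M0 in \<open>auto intro: sum_nonneg\<close>)
  then show ?thesis ..
qed

lemma bspline_differentiable:
  assumes "j + p + 1 < length \<xi>" "z \<notin> set \<xi>"
  shows "bspline \<xi> p j differentiable at z"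
proof -
  have "open (- set \<xi>)" by (simp add: finite_imp_closed open_Compl)
  then obtain e where e: "e > 0" "cball z e \<subseteq> - set \<xi>"
    using assms(2) open_contains_cball_eq[of "- set \<xi>"] by (metis ComplI)
  then have "set \<xi> \<inter> {z - e<..<z + e} = {}" by (force simp: dist_real_def subset_iff)
  then obtain P where P: "\<And>x. x \<in> {z - e..<z + e} \<Longrightarrow> bspline \<xi> p j x = poly P x"
    using bspline_poly_on_span[OF assms(1), of "z - e" "z + e"] e(1)
    by (metis diff_less_eq less_add_same_cancel1 less_trans)
  have "poly P differentiable at z"
    using poly_DERIV[of P z] by (auto simp: differentiable_def has_field_derivative_def)
  then show ?thesis
    by (rule differentiable_transform_within[of _ _ _ e]) (use e in \<open>auto simp: P dist_real_def abs_less_iff\<close>)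
qed

lemma lipschitz_on_bounded_image:
  fixes f :: "'a::heine_borel \<Rightarrow> 'b::heine_borel"
  assumes "L-lipschitz_on S f" "bounded S"
  shows "bounded (f ` S)"
  by (rule bounded_uniformly_continuous_image[OF lipschitz_on_uniformly_continuous[OF assms(1)] assms(2)])

lemma lipschitz_on_times:
  fixes f g :: "'a::heine_borel \<Rightarrow> real"
  assumes "\<exists>L. L-lipschitz_on S f" "\<exists>L. L-lipschitz_on S g" "bounded S"
  shows "\<exists>L. L-lipschitz_on S (\<lambda>x. f x * g x)"
proof -
  obtain K L where KL: "K-lipschitz_on S f" "L-lipschitz_on S g" using assms by blast
  obtain A B where AB: "A > 0" "B > 0" "\<And>x. x \<in> S \<Longrightarrow> \<bar>f x\<bar> \<le> A" "\<And>x. x \<in> S \<Longrightarrow> \<bar>g x\<bar> \<le> B"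
    using lipschitz_on_bounded_image[OF KL(1) assms(3)] lipschitz_on_bounded_image[OF KL(2) assms(3)]
    by (auto simp: bounded_pos)
  have "(A * L + K * B)-lipschitz_on S (\<lambda>x. f x * g x)"
  proof (rule lipschitz_onI)
    fix x y assume xy: "x \<in> S" "y \<in> S"
    have "\<bar>f x * g x - f y * g y\<bar> = \<bar>f x * (g x - g y) + (f x - f y) * g y\<bar>"
      by (simp add: algebra_simps)
    also have "\<dots> \<le> \<bar>f x\<bar> * \<bar>g x - g y\<bar> + \<bar>f x - f y\<bar> * \<bar>g y\<bar>"
      by (metis abs_mult abs_triangle_ineq)
    also have "\<dots> \<le> A * (L * dist x y) + (K * dist x y) * B"
      using lipschitz_onD[OF KL(1) xy] lipschitz_onD[OF KL(2) xy] AB xy lipschitz_on_nonneg[OF KL(1)]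
      by (intro add_mono mult_mono) (auto simp: dist_real_def)
    finally show "dist (f x * g x) (f y * g y) \<le> (A * L + K * B) * dist x y"
      by (simp add: dist_real_def algebra_simps)
  qed (use AB KL lipschitz_on_nonneg in \<open>auto intro!: add_nonneg_nonneg mult_nonneg_nonneg\<close>)
  then show ?thesis ..
qed

lemma tensor_bspline_lipschitz:
  fixes \<Xi> :: "'n::finite \<Rightarrow> real list"
  assumes "\<And>i. open_knot_vector p (\<Xi> i)" "j \<in> bspline_indices \<Xi> p"
  shows "\<exists>L. L-lipschitz_on (box 0 1) (tensor_bspline \<Xi> p j)"
proof -
  have factor: "\<exists>L. L-lipschitz_on (box 0 1) (\<lambda>x::real^'n. bspline (\<Xi> i) p (j i) (x $ i))" for i
  proof -
    have "j i + p + 1 < length (\<Xi> i)" using assms(2) by (auto simp: bspline_indices_def less_diff_conv)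
    then obtain L where L: "L-lipschitz_on {0<..<1} (bspline (\<Xi> i) p (j i))"
      using bspline_lipschitz assms(1) by blast
    have "L-lipschitz_on (box 0 1) (\<lambda>x::real^'n. bspline (\<Xi> i) p (j i) (x $ i))"
    proof (rule lipschitz_onI)
      fix x y :: "real^'n" assume "x \<in> box 0 1" "y \<in> box 0 1"
      then have "dist (bspline (\<Xi> i) p (j i) (x $ i)) (bspline (\<Xi> i) p (j i) (y $ i)) \<le> L * dist (x $ i) (y $ i)"
        by (intro lipschitz_onD[OF L]) (auto simp: mem_box_cart)
      also have "\<dots> \<le> L * dist x y"
        by (intro mult_left_mono dist_vec_nth_le lipschitz_on_nonneg[OF L])
      finally show "dist (bspline (\<Xi> i) p (j i) (x $ i)) (bspline (\<Xi> i) p (j i) (y $ i)) \<le> L * dist x y" .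
    qed (rule lipschitz_on_nonneg[OF L])
    then show ?thesis ..
  qed
  have "\<exists>L. L-lipschitz_on (box 0 1) (\<lambda>x::real^'n. \<Prod>i\<in>A. bspline (\<Xi> i) p (j i) (x $ i))"
    if "finite A" for A
    using that
  proof (induction A rule: finite_induct)
    case empty
    show ?case by (auto intro: lipschitz_on_constant)
  next
    case (insert i A)
    show ?case
      using insert.hyps lipschitz_on_times[of _ "\<lambda>x. bspline (\<Xi> i) p (j i) (x $ i)", OF factor insert.IH bounded_box]
      by simp
  qed
  then show ?thesis unfolding tensor_bspline_def by simp
qed

lemma bspline_space_lipschitz:
  fixes \<Xi> :: "'n::finite \<Rightarrow> real list"
  assumes "\<And>i. open_knot_vector p (\<Xi> i)" "f \<in> bspline_space \<Xi> p"
  shows "\<exists>L. L-lipschitz_on (box 0 1) f"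
proof -
  obtain c where f: "f = (\<lambda>x. \<Sum>j\<in>bspline_indices \<Xi> p. c j * tensor_bspline \<Xi> p j x)"
    using assms(2) by (auto simp: bspline_space_def)
  have "\<exists>L. L-lipschitz_on (box 0 1) (\<lambda>x. \<Sum>j\<in>A. c j * tensor_bspline \<Xi> p j x)"
    if "A \<subseteq> bspline_indices \<Xi> p" for A
    using that
  proof (induction A rule: infinite_finite_induct)
    case (insert j A)
    obtain K where "K-lipschitz_on (box 0 1) (\<lambda>x. \<Sum>j\<in>A. c j * tensor_bspline \<Xi> p j x)"
      using insert by auto
    moreover have "\<exists>L. L-lipschitz_on (box 0 1) (\<lambda>x. c j * tensor_bspline \<Xi> p j x)"
    proof (rule lipschitz_on_times)
      show "\<exists>L. L-lipschitz_on (box 0 1) (tensor_bspline \<Xi> p j)"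
        by (rule tensor_bspline_lipschitz) (use assms(1) insert.prems in auto)
    qed (use lipschitz_on_constant bounded_box in \<open>blast+\<close>)
    then obtain L where "L-lipschitz_on (box 0 1) (\<lambda>x. c j * tensor_bspline \<Xi> p j x)" ..
    ultimately have "(L + K)-lipschitz_on (box 0 1) (\<lambda>x. c j * tensor_bspline \<Xi> p j x + (\<Sum>j\<in>A. c j * tensor_bspline \<Xi> p j x))"
      by (intro lipschitz_on_add)
    then show ?case using insert.hyps by auto
  qed (auto intro: lipschitz_on_constant)
  then show ?thesis unfolding f by blast
qed

lemma bspline_space_differentiable:
  fixes \<Xi> :: "'n::finite \<Rightarrow> real list"
  assumes "f \<in> bspline_space \<Xi> p" "\<And>i. x $ i \<notin> set (\<Xi> i)"
  shows "f differentiable at x"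
proof -
  obtain c where f: "f = (\<lambda>x. \<Sum>j\<in>bspline_indices \<Xi> p. c j * tensor_bspline \<Xi> p j x)"
    using assms(1) by (auto simp: bspline_space_def)
  have t: "tensor_bspline \<Xi> p j differentiable at x" if "j \<in> bspline_indices \<Xi> p" for j
  proof -
    have "(\<lambda>y::real^'n. bspline (\<Xi> i) p (j i) (y $ i)) differentiable at x" for i
    proof -
      have "j i + p + 1 < length (\<Xi> i)" using that by (auto simp: bspline_indices_def less_diff_conv)
      then obtain D where "(bspline (\<Xi> i) p (j i) has_derivative D) (at (x $ i))"
        using bspline_differentiable assms(2) unfolding differentiable_def by blast
      then have "((\<lambda>y::real^'n. bspline (\<Xi> i) p (j i) (y $ i)) has_derivative (\<lambda>h. D (h $ i))) (at x)"
        by (rule has_derivative_compose[rotated])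
          (auto intro: bounded_linear_imp_has_derivative bounded_linear_vec_nth)
      then show ?thesis unfolding differentiable_def by blast
    qed
    then have "\<exists>D. \<forall>i. ((\<lambda>y::real^'n. bspline (\<Xi> i) p (j i) (y $ i)) has_derivative D i) (at x)"
      unfolding differentiable_def by metis
    then obtain D where "\<And>i. ((\<lambda>y::real^'n. bspline (\<Xi> i) p (j i) (y $ i)) has_derivative D i) (at x)"
      by blast
    from has_derivative_prod[of UNIV "\<lambda>i y. bspline (\<Xi> i) p (j i) (y $ i)", OF this] show ?thesis
      unfolding tensor_bspline_def differentiable_def by blast
  qed
  show ?thesis
  proof (cases "finite (bspline_indices \<Xi> p)")
    case True
    then show ?thesis unfolding f using t by (intro differentiable_sum differentiable_mult) auto
  qed (simp add: f)
qed

subsection \<open>Regularity of mapped splines\<close>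

lemma directional_difference_quotient:
  assumes "(f has_derivative D) (at x)"
  shows "((\<lambda>t. (f (x + t *\<^sub>R v) - f x) /\<^sub>R t) \<longlongrightarrow> D v) (at 0)"
proof -
  have "((\<lambda>t. x + t *\<^sub>R v) has_derivative (\<lambda>t. t *\<^sub>R v)) (at 0)"
    by (auto intro!: derivative_eq_intros)
  then have "((\<lambda>t. f (x + t *\<^sub>R v)) has_derivative (\<lambda>t. D (t *\<^sub>R v))) (at 0)"
    by (rule has_derivative_compose) (use assms in simp)
  also have "(\<lambda>t. D (t *\<^sub>R v)) = (\<lambda>t. t *\<^sub>R D v)"
    using has_derivative_linear[OF assms] linear_scale by blast
  finally have "((\<lambda>t. norm (f (x + t *\<^sub>R v) - f x - t *\<^sub>R D v) / norm t) \<longlongrightarrow> 0) (at 0)"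
    by (simp add: has_derivative_at)
  moreover have "\<forall>\<^sub>F t in at (0::real). norm (f (x + t *\<^sub>R v) - f x - t *\<^sub>R D v) / norm t =
      norm ((f (x + t *\<^sub>R v) - f x) /\<^sub>R t - D v)"
    unfolding eventually_at_filter
  proof (intro always_eventually allI impI)
    fix t :: real assume "t \<noteq> 0"
    then have "f (x + t *\<^sub>R v) - f x - t *\<^sub>R D v = t *\<^sub>R ((f (x + t *\<^sub>R v) - f x) /\<^sub>R t - D v)"
      by (simp add: scaleR_diff_right)
    then show "norm (f (x + t *\<^sub>R v) - f x - t *\<^sub>R D v) / norm t = norm ((f (x + t *\<^sub>R v) - f x) /\<^sub>R t - D v)"
      using \<open>t \<noteq> 0\<close> by (metis nonzero_mult_div_cancel_left norm_eq_zero norm_scaleR real_norm_def)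
  qed
  ultimately have "((\<lambda>t. norm ((f (x + t *\<^sub>R v) - f x) /\<^sub>R t - D v)) \<longlongrightarrow> 0) (at 0)"
    by (rule Lim_transform_eventually)
  then have "((\<lambda>t. (f (x + t *\<^sub>R v) - f x) /\<^sub>R t - D v) \<longlongrightarrow> 0) (at 0)"
    by (rule tendsto_norm_zero_cancel)
  then show ?thesis by (rule LIM_zero_cancel)
qed

lemma has_derivative_norm_le:
  fixes f :: "'a::real_normed_vector \<Rightarrow> 'b::real_normed_vector"
  assumes D: "(f has_derivative D) (at x)" and "open S" "x \<in> S"
    and lip: "\<And>y. y \<in> S \<Longrightarrow> norm (f y - f x) \<le> L * norm (y - x)"
  shows "norm (D v) \<le> L * norm v"
proof (rule tendsto_upperbound)
  show "((\<lambda>t. norm ((f (x + t *\<^sub>R v) - f x) /\<^sub>R t)) \<longlongrightarrow> norm (D v)) (at 0)"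
    by (intro tendsto_norm directional_difference_quotient D)
  have "((\<lambda>t. x + t *\<^sub>R v) \<longlongrightarrow> x + 0 *\<^sub>R v) (at 0)" by (intro tendsto_intros)
  then have "eventually (\<lambda>t. x + t *\<^sub>R v \<in> S) (at 0)"
    using topological_tendstoD[of _ "x + 0 *\<^sub>R v" "at 0" S] assms by auto
  moreover have "eventually (\<lambda>t::real. t \<noteq> 0) (at 0)" by (simp add: eventually_at_filter)
  ultimately show "eventually (\<lambda>t. norm ((f (x + t *\<^sub>R v) - f x) /\<^sub>R t) \<le> L * norm v) (at 0)"
  proof eventually_elim
    case (elim t)
    then have "norm ((f (x + t *\<^sub>R v) - f x) /\<^sub>R t) \<le> (L * norm (t *\<^sub>R v)) / \<bar>t\<bar>"
      using lip[of "x + t *\<^sub>R v"] by (simp add: divide_simps mult_ac)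
    also have "\<dots> = L * norm v" using elim by simp
    finally show ?case .
  qed
qed simp

lemma abs_det_column_replaced_le:
  fixes A :: "real^'n^'n"
  assumes "\<And>i j. \<bar>A $ i $ j\<bar> \<le> L" "L \<ge> 1"
  shows "\<bar>det (\<chi> i j. if j = k then w $ i else A $ i $ j)\<bar>
           \<le> real (card {p. p permutes (UNIV::'n set)}) * (norm w * L ^ CARD('n))"
proof -
  have "\<bar>of_int (sign p) * (\<Prod>i\<in>UNIV. (if p i = k then w $ i else A $ i $ p i))\<bar> \<le> norm w * L ^ CARD('n)"
    if p: "p permutes (UNIV::'n set)" for p
  proof -
    have "\<bar>of_int (sign p) * (\<Prod>i\<in>UNIV. (if p i = k then w $ i else A $ i $ p i))\<bar>
        = (\<Prod>i\<in>UNIV. \<bar>if p i = k then w $ i else A $ i $ p i\<bar>)"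
      by (simp add: abs_mult abs_prod sign_def)
    also have "\<dots> \<le> (\<Prod>i\<in>UNIV. if p i = k then norm w else L)"
      using assms by (intro prod_mono) (auto simp: component_le_norm_cart)
    also have "\<dots> = (\<Prod>j\<in>UNIV. if j = k then norm w else L)"
      using p by (intro prod.reindex_bij_betw) (rule permutes_imp_bij)
    also have "\<dots> = norm w * L ^ (CARD('n) - 1)"
      by (simp add: prod.delta_remove)
    also have "\<dots> \<le> norm w * L ^ CARD('n)"
      using assms by (intro mult_left_mono power_increasing) auto
    finally show ?thesis .
  qed
  then show ?thesis
    unfolding det_def by (intro order.trans[OF sum_abs] order.trans[OF sum_bounded_above]) auto
qed

text \<open>Cramer's rule bounds the inverse by the entries and the determinant.\<close>

lemma norm_le_of_det_ge:
  assumes "b > 0" "L \<ge> 0"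
  obtains K where "K \<ge> 0"
    "\<And>A v. \<lbrakk>\<And>v. norm (A *v v) \<le> L * norm v; b \<le> \<bar>det A\<bar>\<rbrakk> \<Longrightarrow> norm v \<le> K * norm ((A::real^'n^'n) *v v)"
proof
  define M where "M = max L 1"
  define N where "N = real (card {p. p permutes (UNIV::'n set)})"
  define K where "K = real CARD('n) * (N * M ^ CARD('n) / b)"
  have M: "M \<ge> 1" "L \<le> M" by (auto simp: M_def)
  show "K \<ge> 0" using assms M by (simp add: K_def N_def)
  fix A :: "real^'n^'n" and v
  assume A: "\<And>v. norm (A *v v) \<le> L * norm v" "b \<le> \<bar>det A\<bar>"
  define w where "w = A *v v"
  have entry: "\<bar>A $ i $ j\<bar> \<le> M" for i j
  proof -
    have "\<bar>A $ i $ j\<bar> = \<bar>(A *v axis j 1) $ i\<bar>" by (simp add: matrix_vector_mul_component inner_axis)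
    also have "\<dots> \<le> norm (A *v axis j 1)" by (rule component_le_norm_cart)
    also have "\<dots> \<le> L" using A(1)[of "axis j 1"] by simp
    finally show ?thesis using M by simp
  qed
  have "det A \<noteq> 0" using A assms by auto
  then have v: "v = (\<chi> k. det (\<chi> i j. if j = k then w $ i else A $ i $ j) / det A)"
    using cramer[of A v w] by (simp add: w_def)
  have "\<bar>v $ k\<bar> \<le> N * M ^ CARD('n) / b * norm w" for k
  proof -
    have "\<bar>v $ k\<bar> = \<bar>det (\<chi> i j. if j = k then w $ i else A $ i $ j)\<bar> / \<bar>det A\<bar>"
      by (subst v) simp
    also have "\<dots> \<le> (N * (norm w * M ^ CARD('n))) / b"
      using abs_det_column_replaced_le[of A M k w, OF entry M(1)] A assms
      by (intro frac_le) (auto simp: N_def)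
    finally show ?thesis by (simp add: field_simps)
  qed
  then have "(\<Sum>k\<in>UNIV. \<bar>v $ k\<bar>) \<le> K * norm w"
    unfolding K_def by (intro order.trans[OF sum_bounded_above]) (auto simp: mult.assoc)
  then show "norm v \<le> K * norm (A *v v)"
    using norm_le_l1_cart[of v] by (simp add: w_def)
qed

lemma lipschitz_on_cart:
  fixes f :: "'a::metric_space \<Rightarrow> real^'n"
  assumes "\<And>i. \<exists>L. L-lipschitz_on S (\<lambda>x. f x $ i)"
  shows "\<exists>L. L-lipschitz_on S f"
proof -
  obtain L where L: "\<And>i. (L i)-lipschitz_on S (\<lambda>x. f x $ i)" using assms by metis
  have "(\<Sum>i\<in>UNIV. L i)-lipschitz_on S f"
  proof (rule lipschitz_onI)
    fix x y assume xy: "x \<in> S" "y \<in> S"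
    have "dist (f x) (f y) \<le> (\<Sum>i\<in>UNIV. \<bar>(f x - f y) $ i\<bar>)"
      unfolding dist_norm by (rule norm_le_l1_cart)
    also have "\<dots> \<le> (\<Sum>i\<in>UNIV. L i * dist x y)"
      using lipschitz_onD[OF L xy] by (intro sum_mono) (simp add: dist_real_def)
    finally show "dist (f x) (f y) \<le> (\<Sum>i\<in>UNIV. L i) * dist x y" by (simp add: sum_distrib_right)
  qed (intro sum_nonneg lipschitz_on_nonneg[OF L])
  then show ?thesis ..
qed

lemma bspline_parametrization_inverse:
  fixes \<Phi> :: "real^'n \<Rightarrow> real^'n"
  assumes "bspline_parametrization \<Phi> P"
  obtains K where "K \<ge> 0"
    "\<And>y. y \<in> P \<Longrightarrow> \<exists>D. (inv_into (box 0 1) \<Phi> has_derivative D) (at y) \<and> (\<forall>v. norm (D v) \<le> K * norm v)"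
proof -
  have bij: "bij_betw \<Phi> (box 0 1) P"
    and diff: "\<And>x. x \<in> box 0 1 \<Longrightarrow> \<Phi> differentiable at x"
    using assms by (auto simp: bspline_parametrization_def)
  obtain \<Xi> q where knots: "\<And>i. open_knot_vector q (\<Xi> i)"
    and comp: "\<And>i. \<exists>f\<in>bspline_space \<Xi> q. \<forall>x\<in>box 0 1. \<Phi> x $ i = f x"
    using assms unfolding bspline_parametrization_def by auto
  obtain b where b: "0 < b" "\<And>x. x \<in> box 0 1 \<Longrightarrow> b \<le> \<bar>det (jacobian \<Phi> x)\<bar>"
    using assms unfolding bspline_parametrization_def by auto
  have "\<exists>L. L-lipschitz_on (box 0 1) (\<lambda>x. \<Phi> x $ i)" for i
    using comp[of i] bspline_space_lipschitz[of q \<Xi>, OF knots] lipschitz_on_transform by metis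
  then obtain L where L: "L-lipschitz_on (box 0 1) \<Phi>"
    using lipschitz_on_cart by blast
  obtain K where K: "K \<ge> 0"
    "\<And>A v. \<lbrakk>\<And>v. norm (A *v v) \<le> L * norm v; b \<le> \<bar>det A\<bar>\<rbrakk> \<Longrightarrow> norm v \<le> K * norm ((A::real^'n^'n) *v v)"
    using norm_le_of_det_ge[OF b(1) lipschitz_on_nonneg[OF L]] by blast
  have "\<exists>D. (inv_into (box 0 1) \<Phi> has_derivative D) (at y) \<and> (\<forall>v. norm (D v) \<le> K * norm v)" if "y \<in> P" for y
  proof -
    obtain x where x: "x \<in> box 0 1" "\<Phi> x = y" using \<open>y \<in> P\<close> bij_betw_imp_surj_on[OF bij] by blast
    let ?J = "\<lambda>x. jacobian \<Phi> x"
    have der: "(\<Phi> has_derivative (*v) (?J z)) (at z)" if "z \<in> box 0 1" for z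
    proof -
      have "(\<Phi> has_derivative frechet_derivative \<Phi> (at z)) (at z)"
        using diff[OF that] frechet_derivative_works by blast
      moreover from this have "(*v) (?J z) = frechet_derivative \<Phi> (at z)"
        using matrix_vector_mul(2)[OF has_derivative_linear] by blast
      ultimately show ?thesis by simp
    qed
    have "det (?J x) \<noteq> 0" using b x(1) by fastforce
    then obtain B where B: "?J x ** B = mat 1"
      unfolding invertible_det_nz[symmetric] invertible_def by blast
    have "(inv_into (box 0 1) \<Phi> has_derivative (*v) B) (at (\<Phi> x))"
    proof (rule has_derivative_inverse_on[where f = \<Phi> and x = x and g = "inv_into (box 0 1) \<Phi>" and f' = "\<lambda>z. (*v) (?J z)" and g' = "\<lambda>z. (*v) B"
          and S = "box 0 1"])
      show "inv_into (box 0 1) \<Phi> (\<Phi> z) = z" if "z \<in> box 0 1" for z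
        using bij that by (auto simp: bij_betw_def)
      show "(*v) (?J x) \<circ> (*v) B = id"
        using B by (auto simp: fun_eq_iff matrix_vector_mul_assoc)
    qed (use der x in auto)
    moreover have "norm (B *v v) \<le> K * norm v" for v
    proof -
      have "norm (?J x *v u) \<le> L * norm u" for u
        by (rule has_derivative_norm_le[OF der[OF x(1)] open_box x(1)])
          (use lipschitz_onD[OF L _ x(1)] in \<open>simp add: dist_norm\<close>)
      then have "norm (B *v v) \<le> K * norm (?J x *v (B *v v))"
        using b(2)[OF x(1)] by (intro K) auto
      also have "?J x *v (B *v v) = v"
        using B by (simp add: matrix_vector_mul_assoc)
      finally show ?thesis .
    qed
    ultimately show ?thesis using x by auto
  qed
  then show ?thesis using that K(1) by blast
qed

lemma negligible_knot_hyperplanes: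
  fixes \<Xi> :: "'n::finite \<Rightarrow> real list"
  shows "negligible {x :: real^'n. \<exists>i. x $ i \<in> set (\<Xi> i)}"
proof -
  have hyperplane: "negligible {x :: real^'n. x $ i = k}" for i k
    using negligible_standard_hyperplane[of "axis i 1 :: real^'n" k]
    by (simp add: cart_eq_inner_axis axis_in_Basis_iff)
  have "{x :: real^'n. \<exists>i. x $ i \<in> set (\<Xi> i)} = (\<Union>i. \<Union>k\<in>set (\<Xi> i). {x. x $ i = k})" by auto
  also have "negligible \<dots>"
    by (intro negligible_Union finite_imageI) (auto intro!: negligible_Union hyperplane)
  finally show ?thesis .
qed

lemma mapped_bspline_regularity:
  fixes \<Phi> :: "real^'n \<Rightarrow> real^'n"
  assumes "\<And>i. open_knot_vector p (\<Xi> i)" "bspline_parametrization \<Phi> P"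
    "\<phi> \<in> mapped_bspline_space \<Xi> p \<Phi>"
  obtains L N where "L \<ge> 0" "bounded (\<phi> ` P)"
    "\<And>x y. closed_segment x y \<subseteq> P \<Longrightarrow> \<bar>\<phi> x - \<phi> y\<bar> \<le> L * norm (x - y)"
    "negligible N" "\<And>x. x \<in> P - N \<Longrightarrow> \<phi> differentiable at x"
proof -
  define \<Psi> where "\<Psi> = inv_into (box 0 1) \<Phi>"
  have bij: "bij_betw \<Phi> (box 0 1) P"
    and diff: "\<And>x. x \<in> box 0 1 \<Longrightarrow> \<Phi> differentiable at x"
    using assms(2) by (auto simp: bspline_parametrization_def)
  obtain f where f: "f \<in> bspline_space \<Xi> p" "\<phi> = f \<circ> \<Psi>"
    using assms(3) by (auto simp: mapped_bspline_space_def \<Psi>_def)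
  have \<Psi>: "\<Psi> x \<in> box 0 1" "\<Phi> (\<Psi> x) = x" if "x \<in> P" for x
    using bij that unfolding \<Psi>_def bij_betw_def by (auto intro: inv_into_into f_inv_into_f)
  obtain L where L: "L-lipschitz_on (box 0 1) f"
    using bspline_space_lipschitz[of p \<Xi>, OF assms(1) f(1)] by blast
  obtain K where K: "K \<ge> 0"
    "\<And>y. y \<in> P \<Longrightarrow> \<exists>D. (\<Psi> has_derivative D) (at y) \<and> (\<forall>v. norm (D v) \<le> K * norm v)"
    using bspline_parametrization_inverse[OF assms(2)] unfolding \<Psi>_def by blast
  show ?thesis
  proof
    show "L * K \<ge> 0" using K(1) lipschitz_on_nonneg[OF L] by simp
    have "bounded (f ` box 0 1)" by (rule lipschitz_on_bounded_image[OF L bounded_box])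
    then show "bounded (\<phi> ` P)" by (rule bounded_subset) (use f \<Psi> in auto)
    show "\<bar>\<phi> x - \<phi> y\<bar> \<le> L * K * norm (x - y)" if seg: "closed_segment x y \<subseteq> P" for x y
    proof -
      obtain D where D: "\<And>y. y \<in> P \<Longrightarrow> (\<Psi> has_derivative D y) (at y)"
        "\<And>y v. y \<in> P \<Longrightarrow> norm (D y v) \<le> K * norm v"
        using K(2) by metis
      have "norm (\<Psi> x - \<Psi> y) \<le> K * norm (x - y)"
      proof (rule differentiable_bound[where S = "closed_segment x y"])
        show "(\<Psi> has_derivative D z) (at z within closed_segment x y)" if "z \<in> closed_segment x y" for z
          using D(1) seg that by (blast intro: has_derivative_at_withinI)
        show "onorm (D z) \<le> K" if "z \<in> closed_segment x y" for z
          using D(2) seg that by (intro onorm_le) blast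
      qed auto
      moreover have "\<bar>\<phi> x - \<phi> y\<bar> \<le> L * norm (\<Psi> x - \<Psi> y)"
        using lipschitz_onD[OF L, of "\<Psi> x" "\<Psi> y"] \<Psi>(1) seg f(2) by (auto simp: dist_real_def dist_norm)
      ultimately show ?thesis
        using lipschitz_on_nonneg[OF L] mult_left_mono by (fastforce simp: mult.assoc)
    qed
    let ?K = "{x \<in> box 0 1. \<exists>i. x $ i \<in> set (\<Xi> i)}"
    show "negligible (\<Phi> ` ?K)"
    proof (rule negligible_differentiable_image_negligible)
      show "negligible ?K" using negligible_knot_hyperplanes by (rule negligible_subset) auto
      show "\<Phi> differentiable_on ?K"
        using diff by (auto simp: differentiable_on_def intro: differentiable_at_withinI)
    qed simp
    show "\<phi> differentiable at x" if "x \<in> P - \<Phi> ` ?K" for x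
    proof -
      have "f differentiable at (\<Psi> x)"
        using f(1) by (rule bspline_space_differentiable) (use that \<Psi>[of x] in force)
      moreover have "\<Psi> differentiable at x" using K(2)[of x] that by (auto simp: differentiable_def)
      ultimately show ?thesis
        unfolding f(2) by (intro differentiable_chain_at)
    qed
  qed
qed

subsection \<open>Integration along a direction\<close>

lemma nn_integral_lborel_translate:
  fixes f :: "'a::euclidean_space \<Rightarrow> ennreal"
  assumes [measurable]: "f \<in> borel_measurable borel"
  shows "(\<integral>\<^sup>+x. f (c + x) \<partial>lborel) = (\<integral>\<^sup>+x. f x \<partial>lborel)"
proof -
  have "(\<integral>\<^sup>+x. f x \<partial>lborel) = (\<integral>\<^sup>+x. f x \<partial>distr lborel borel ((+) c))"
    by (simp add: lborel_distr_plus)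
  also have "\<dots> = (\<integral>\<^sup>+x. f (c + x) \<partial>lborel)" by (rule nn_integral_distr) auto
  finally show ?thesis by simp
qed

text \<open>
  Uniqueness of Haar measure: integrate \<open>F (T x) 1\<^sub>B (y - T x)\<close> over both spaces, where \<open>B\<close> is the
  unit ball, and substitute \<open>x \<mapsto> T\<^sup>-\<^sup>1 y + x\<close> after exchanging the order of integration.
\<close>

lemma nn_integral_linear_isometry:
  fixes T :: "'a::euclidean_space \<Rightarrow> 'b::euclidean_space"
  assumes "linear T" and iso: "\<And>x. norm (T x) = norm x" and "surj T"
  obtains \<kappa> :: real where "\<kappa> > 0"
    "\<And>a F. F \<in> borel_measurable borel \<Longrightarrow>
       (\<integral>\<^sup>+y. F y \<partial>lborel) = ennreal \<kappa> * (\<integral>\<^sup>+x. F (a + T x) \<partial>lborel)"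
proof
  define b where "b = measure lborel (ball 0 1 :: 'b set)"
  define c where "c = measure lborel (ball 0 1 :: 'a set)"
  have eb: "emeasure lborel (ball 0 1 :: 'b set) = ennreal b" and ec: "emeasure lborel (ball 0 1 :: 'a set) = ennreal c"
    unfolding b_def c_def
    by (intro emeasure_eq_ennreal_measure less_imp_neq[OF emeasure_lborel_ball_finite, unfolded infinity_ennreal_def])+
  have b: "b > 0" and c: "c > 0"
    unfolding b_def c_def by (auto intro!: content_ball_pos)
  show "b / c > 0" using b c by simp
  have T[measurable]: "T \<in> borel_measurable borel"
    using assms(1) by (intro borel_measurable_continuous_onI linear_continuous_on linear_conv_bounded_linear[THEN iffD1])
  fix a and F :: "'b \<Rightarrow> ennreal" assume [measurable]: "F \<in> borel_measurable borel"
  define G where "G = (\<lambda>y. F (a + y))"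
  have G[measurable]: "G \<in> borel_measurable borel" unfolding G_def by simp
  let ?B = "indicator (ball 0 1) :: 'b \<Rightarrow> ennreal"
  have [measurable]: "ball 0 1 \<in> sets (borel :: 'b measure)" "ball 0 1 \<in> sets (borel :: 'a measure)" by auto
  have "ennreal b * (\<integral>\<^sup>+x. G (T x) \<partial>lborel) = (\<integral>\<^sup>+x. G (T x) * ennreal b \<partial>lborel)"
    by (subst nn_integral_multc) (auto simp: mult.commute)
  also have "\<dots> = (\<integral>\<^sup>+x. G (T x) * (\<integral>\<^sup>+y. ?B (- T x + y) \<partial>lborel) \<partial>lborel)"
    by (subst nn_integral_lborel_translate) (auto simp: eb)
  also have "\<dots> = (\<integral>\<^sup>+x. (\<integral>\<^sup>+y. G (T x) * ?B (- T x + y) \<partial>lborel) \<partial>lborel)"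
    by (subst nn_integral_cmult) auto
  also have "\<dots> = (\<integral>\<^sup>+y. (\<integral>\<^sup>+x. G (T x) * ?B (- T x + y) \<partial>lborel) \<partial>lborel)"
    by (rule lborel_pair.Fubini'[symmetric]) simp
  also have "\<dots> = (\<integral>\<^sup>+y. (\<integral>\<^sup>+x. G (y + T x) * indicator (ball 0 1) x \<partial>lborel) \<partial>lborel)"
  proof (rule nn_integral_cong)
    fix y
    obtain z where z: "T z = y" using \<open>surj T\<close> by (metis surjD)
    have "(\<integral>\<^sup>+x. G (T x) * ?B (- T x + y) \<partial>lborel) = (\<integral>\<^sup>+x. G (T (z + x)) * ?B (- T (z + x) + y) \<partial>lborel)"
      by (rule nn_integral_lborel_translate[symmetric]) simp
    also have "\<dots> = (\<integral>\<^sup>+x. G (y + T x) * indicator (ball 0 1) x \<partial>lborel)"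
      using z iso by (intro nn_integral_cong) (simp add: linear_add[OF assms(1)] indicator_def)
    finally show "(\<integral>\<^sup>+x. G (T x) * ?B (- T x + y) \<partial>lborel) = (\<integral>\<^sup>+x. G (y + T x) * indicator (ball 0 1) x \<partial>lborel)" .
  qed
  also have "\<dots> = (\<integral>\<^sup>+x. (\<integral>\<^sup>+y. G (y + T x) * indicator (ball 0 1) x \<partial>lborel) \<partial>lborel)"
    by (rule lborel_pair.Fubini') simp
  also have "\<dots> = (\<integral>\<^sup>+x. (\<integral>\<^sup>+y. G (T x + y) \<partial>lborel) * indicator (ball 0 1) x \<partial>lborel)"
    by (subst nn_integral_multc) (auto simp: add.commute)
  also have "\<dots> = (\<integral>\<^sup>+y. G y \<partial>lborel) * ennreal c"
    by (subst nn_integral_lborel_translate) (auto simp: ec nn_integral_cmult)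
  also have "(\<integral>\<^sup>+y. G y \<partial>lborel) = (\<integral>\<^sup>+y. F y \<partial>lborel)"
    unfolding G_def by (rule nn_integral_lborel_translate) simp
  finally have eq: "ennreal b * (\<integral>\<^sup>+x. G (T x) \<partial>lborel) = (\<integral>\<^sup>+y. F y \<partial>lborel) * ennreal c" .
  have "(\<integral>\<^sup>+y. F y \<partial>lborel) = (\<integral>\<^sup>+y. F y \<partial>lborel) * (ennreal c * ennreal (1 / c))"
    using c by (simp add: ennreal_mult[symmetric])
  also have "\<dots> = ennreal b * (\<integral>\<^sup>+x. G (T x) \<partial>lborel) * ennreal (1 / c)"
    by (simp add: eq mult.assoc)
  also have "\<dots> = ennreal (b / c) * (\<integral>\<^sup>+x. G (T x) \<partial>lborel)"
    using b c ennreal_mult[of b "1 / c"] by (simp add: mult_ac)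
  finally show "(\<integral>\<^sup>+y. F y \<partial>lborel) = ennreal (b / c) * (\<integral>\<^sup>+x. F (a + T x) \<partial>lborel)"
    unfolding G_def .
qed

text \<open>
  The difference quotients of \<open>g\<close> are bounded by \<open>L\<close>, so their integrals converge to that of \<open>D\<close>
  by dominated convergence, and to \<open>g y - g x\<close> because \<open>g\<close> is the derivative of its integral.
\<close>

lemma lipschitz_FTC:
  fixes g D :: "real \<Rightarrow> real"
  assumes lip: "L-lipschitz_on {u<..<v} g" and D[measurable]: "D \<in> borel_measurable borel"
    and der: "AE t in lborel. t \<in> {u<..<v} \<longrightarrow> (g has_real_derivative D t) (at t)"
    and xy: "u < x" "x \<le> y" "y < v"
  shows "has_bochner_integral lborel (\<lambda>t. D t * indicator {x..y} t) (g y - g x)"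
proof -
  define x' where "x' = (u + x) / 2"
  define y' where "y' = (v + y) / 2"
  have x'y': "u < x'" "x' < x" "y < y'" "y' < v" using xy by (auto simp: x'_def y'_def)
  have contg: "continuous_on {u<..<v} g" by (rule lipschitz_on_continuous_on[OF lip])
  define G where "G = (\<lambda>t. integral {x'..t} g)"
  have G: "(G has_real_derivative g t) (at t)" if "t \<in> {x'<..<y'}" for t
  proof -
    have "(G has_real_derivative g t) (at t within {x'..y'})"
      unfolding G_def
      by (rule integral_has_real_derivative) (use contg x'y' that in \<open>auto intro: continuous_on_subset\<close>)
    moreover have "at t within {x'..y'} = at t" by (rule at_within_Icc_at) (use that in auto)
    ultimately show ?thesis by simp
  qed
  define h where "h = (\<lambda>k. (y' - y) * inverse (real (Suc (Suc k))))"
  have h: "0 < h k" "h k < y' - y" for k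
  proof -
    have "inverse (real (Suc (Suc k))) < 1" by (rule inverse_less_1_iff[THEN iffD2]) simp
    then show "0 < h k" "h k < y' - y"
      using x'y' mult_strict_left_mono[of "inverse (real (Suc (Suc k)))" 1 "y' - y"]
      unfolding h_def by (auto intro: mult_pos_pos)
  qed
  have h0: "h \<longlonglongrightarrow> 0" unfolding h_def
    by (rule tendsto_mult_right_zero[OF LIMSEQ_Suc[OF LIMSEQ_inverse_real_of_nat]])
  have hat: "filterlim h (at 0) sequentially"
    using h0 h(1) by (auto simp: filterlim_at intro!: always_eventually less_imp_neq[THEN not_sym])
  let ?s = "\<lambda>k t. ((g (t + h k) - g t) / h k) * indicator {x..y} t"
  have s: "has_bochner_integral lborel (?s k) ((G (y + h k) - G y) / h k - (G (x + h k) - G x) / h k)" for k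
  proof (rule has_bochner_integral_FTC_Icc_real[where F = "\<lambda>t. (G (t + h k) - G t) / h k"])
      fix t assume t: "x \<le> t" "t \<le> y"
      then have inner: "t \<in> {x'<..<y'}" "t + h k \<in> {x'<..<y'}" using h[of k] x'y' by auto
      have "((\<lambda>t. G (t + h k)) has_real_derivative g (t + h k)) (at t)"
        using G[OF inner(2)] by (simp add: DERIV_shift add.commute)
      then show "((\<lambda>t. (G (t + h k) - G t) / h k) has_real_derivative (g (t + h k) - g t) / h k) (at t)"
        using G[OF inner(1)] by (auto intro!: DERIV_cdivide DERIV_diff)
      have iso: "isCont g z" if "z \<in> {x'<..<y'}" for z
        using contg x'y' that by (auto simp: continuous_on_eq_continuous_at)
      show "isCont (\<lambda>t. (g (t + h k) - g t) / h k) t"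
        using h(1)[of k] iso[OF inner(1)] iso[OF inner(2)]
        by (intro continuous_intros) (auto intro: isCont_o2[of _ _ g])
  qed (use xy in auto)
  have s_meas: "?s k \<in> borel_measurable lborel" for k
    using s[of k] by (auto simp: has_bochner_integral_iff)
  have w: "integrable lborel (\<lambda>t. L * indicator {x..y} t :: real)"
    using xy by (intro integrable_mult_right integrable_real_indicator) auto
  have lim: "AE t in lborel. (\<lambda>k. ?s k t) \<longlonglongrightarrow> D t * indicator {x..y} t"
    using der
  proof eventually_elim
    case (elim t)
    show ?case
    proof (cases "t \<in> {x..y}")
      case True
      then have "(g has_real_derivative D t) (at t)" using elim xy by auto
      then have "((\<lambda>h. (g (t + h) - g t) / h) \<longlongrightarrow> D t) (at 0)" by (simp add: DERIV_def)
      from filterlim_compose[OF this hat] show ?thesis using True by simp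
    qed simp
  qed
  have bound: "AE t in lborel. norm (?s k t) \<le> L * indicator {x..y} t" for k
  proof (intro always_eventually allI)
    fix t
    show "norm (?s k t) \<le> L * indicator {x..y} t"
    proof (cases "t \<in> {x..y}")
      case True
      then have "\<bar>g (t + h k) - g t\<bar> \<le> L * h k"
        using lipschitz_onD[OF lip, of "t + h k" t] h[of k] xy x'y' by (auto simp: dist_real_def)
      then show ?thesis using True h(1)[of k] by (simp add: divide_simps)
    qed simp
  qed
  have meas: "(\<lambda>t. D t * indicator {x..y} t) \<in> borel_measurable lborel" by simp
  have "(\<lambda>k. integral\<^sup>L lborel (?s k)) \<longlonglongrightarrow> (\<integral>t. D t * indicator {x..y} t \<partial>lborel)"
    by (rule integral_dominated_convergence[OF meas s_meas w lim bound])
  moreover have int: "integrable lborel (\<lambda>t. D t * indicator {x..y} t)"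
    by (rule integrable_dominated_convergence[OF meas s_meas w lim bound])
  moreover have "(\<lambda>k. integral\<^sup>L lborel (?s k)) \<longlonglongrightarrow> g y - g x"
  proof -
    have q: "(\<lambda>k. (G (z + h k) - G z) / h k) \<longlonglongrightarrow> g z" if "z \<in> {x..y}" for z
    proof -
      have "((\<lambda>h. (G (z + h) - G z) / h) \<longlongrightarrow> g z) (at 0)"
        using G[of z] that x'y' by (simp add: DERIV_def)
      from filterlim_compose[OF this hat] show ?thesis .
    qed
    have "integral\<^sup>L lborel (?s k) = (G (y + h k) - G y) / h k - (G (x + h k) - G x) / h k" for k
      using s by (rule has_bochner_integral_integral_eq)
    then show ?thesis using xy by (simp only:) (intro tendsto_diff q; simp)
  qed
  ultimately have "(\<integral>t. D t * indicator {x..y} t \<partial>lborel) = g y - g x"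
    using LIMSEQ_unique by blast
  with int show ?thesis by (simp add: has_bochner_integral_iff)
qed

lemma lipschitz_increment_square_le:
  fixes g D :: "real \<Rightarrow> real"
  assumes lip: "L-lipschitz_on {u<..<v} g" and D[measurable]: "D \<in> borel_measurable borel"
    and der: "AE t in lborel. t \<in> {u<..<v} \<longrightarrow> (g has_real_derivative D t) (at t)"
    and "x \<in> {u<..<v}" "y \<in> {u<..<v}"
  shows "ennreal ((g y - g x)\<^sup>2) \<le> ennreal (v - u) * (\<integral>\<^sup>+t. ennreal ((D t)\<^sup>2) * indicator {u<..<v} t \<partial>lborel)"
  using assms(4,5)
proof (induction x y rule: linorder_wlog)
  case (le x y)
  have hb: "has_bochner_integral lborel (\<lambda>t. D t * indicator {x..y} t) (g y - g x)"
    using lipschitz_FTC[OF lip D der] le by auto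
  have "ennreal \<bar>g y - g x\<bar> \<le> (\<integral>\<^sup>+t. norm (D t * indicator {x..y} t) \<partial>lborel)"
    using integral_norm_bound_ennreal[of lborel "\<lambda>t. D t * indicator {x..y} t"] hb
    by (simp add: has_bochner_integral_iff)
  also have "\<dots> \<le> (\<integral>\<^sup>+t. ennreal (\<bar>D t\<bar> * indicator {u<..<v} t) * indicator {u<..<v} t \<partial>lborel)"
    using le by (intro nn_integral_mono) (auto simp: indicator_def abs_mult)
  finally have "(ennreal \<bar>g y - g x\<bar>)\<^sup>2 \<le> (\<integral>\<^sup>+t. ennreal (\<bar>D t\<bar> * indicator {u<..<v} t) * indicator {u<..<v} t \<partial>lborel)\<^sup>2"
    by (rule power_mono) simp
  also have "\<dots> \<le> (\<integral>\<^sup>+t. (ennreal (\<bar>D t\<bar> * indicator {u<..<v} t))\<^sup>2 \<partial>lborel) * (\<integral>\<^sup>+t. (indicator {u<..<v} t)\<^sup>2 \<partial>lborel)"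
    by (rule Cauchy_Schwarz_nn_integral) auto
  also have "(\<integral>\<^sup>+t. (indicator {u<..<v} t)\<^sup>2 \<partial>lborel) = ennreal (v - u)"
    using le by (simp add: power2_eq_square flip: indicator_inter_arith)
  also have "(\<integral>\<^sup>+t. (ennreal (\<bar>D t\<bar> * indicator {u<..<v} t))\<^sup>2 \<partial>lborel)
      = (\<integral>\<^sup>+t. ennreal ((D t)\<^sup>2) * indicator {u<..<v} t \<partial>lborel)"
    by (intro nn_integral_cong) (auto simp: indicator_def ennreal_power)
  finally show ?case by (simp add: ennreal_power mult.commute)
next
  case (sym x y)
  then show ?case by (simp add: power2_commute)
qed

lemma lipschitz_square_integral_le:
  fixes g D :: "real \<Rightarrow> real"
  assumes lip: "L-lipschitz_on {u<..<v} g" and D[measurable]: "D \<in> borel_measurable borel"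
    and der: "AE t in lborel. t \<in> {u<..<v} \<longrightarrow> (g has_real_derivative D t) (at t)"
    and lim: "(g \<longlongrightarrow> \<gamma>) F" and F: "F \<noteq> bot" "eventually (\<lambda>t. t \<in> {u<..<v}) F"
  shows "(\<integral>\<^sup>+t. ennreal ((g t)\<^sup>2) * indicator {u<..<v} t \<partial>lborel) \<le>
     ennreal (2 * (v - u)) * ennreal (\<gamma>\<^sup>2) +
     ennreal (2 * (v - u)\<^sup>2) * (\<integral>\<^sup>+t. ennreal ((D t)\<^sup>2) * indicator {u<..<v} t \<partial>lborel)"
proof -
  define I where "I = (\<integral>\<^sup>+t. ennreal ((D t)\<^sup>2) * indicator {u<..<v} t \<partial>lborel)"
  have uv: "u < v" using eventually_happens'[OF F] by auto
  have "ennreal ((g t)\<^sup>2) \<le> ennreal (2 * \<gamma>\<^sup>2) + ennreal (2 * (v - u)) * I" if t: "t \<in> {u<..<v}" for t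
  proof -
    have "ennreal ((g t - \<gamma>)\<^sup>2) \<le> ennreal (v - u) * I"
    proof (rule tendsto_upperbound)
      show "((\<lambda>s. ennreal ((g t - g s)\<^sup>2)) \<longlongrightarrow> ennreal ((g t - \<gamma>)\<^sup>2)) F"
        by (intro tendsto_ennrealI tendsto_intros lim)
      show "eventually (\<lambda>s. ennreal ((g t - g s)\<^sup>2) \<le> ennreal (v - u) * I) F"
        using F(2) by eventually_elim (unfold I_def, rule lipschitz_increment_square_le[OF lip D der _ t])
    qed (rule F(1))
    then have double: "ennreal 2 * ennreal ((g t - \<gamma>)\<^sup>2) \<le> ennreal 2 * (ennreal (v - u) * I)"
      by (rule mult_left_mono) simp
    have "(g t)\<^sup>2 \<le> 2 * \<gamma>\<^sup>2 + 2 * (g t - \<gamma>)\<^sup>2"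
      using zero_le_power2[of "g t - 2 * \<gamma>"] by (simp add: power2_eq_square algebra_simps)
    then have "ennreal ((g t)\<^sup>2) \<le> ennreal (2 * \<gamma>\<^sup>2 + 2 * (g t - \<gamma>)\<^sup>2)"
      by (rule ennreal_leI)
    also have "\<dots> = ennreal (2 * \<gamma>\<^sup>2) + ennreal 2 * ennreal ((g t - \<gamma>)\<^sup>2)"
      by (simp add: ennreal_mult)
    also have "\<dots> \<le> ennreal (2 * \<gamma>\<^sup>2) + ennreal 2 * (ennreal (v - u) * I)"
      by (intro add_left_mono double)
    also have "ennreal 2 * (ennreal (v - u) * I) = ennreal (2 * (v - u)) * I"
      using uv ennreal_mult[of 2 "v - u"] by (simp add: mult.assoc)
    finally show ?thesis .
  qed
  then have "(\<integral>\<^sup>+t. ennreal ((g t)\<^sup>2) * indicator {u<..<v} t \<partial>lborel) \<le>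
      (\<integral>\<^sup>+t. (ennreal (2 * \<gamma>\<^sup>2) + ennreal (2 * (v - u)) * I) * indicator {u<..<v} t \<partial>lborel)"
    by (intro nn_integral_mono) (auto simp: indicator_def)
  also have "\<dots> = (ennreal (2 * \<gamma>\<^sup>2) + ennreal (2 * (v - u)) * I) * ennreal (v - u)"
    using uv by (simp add: nn_integral_cmult_indicator)
  also have "\<dots> = ennreal (2 * (v - u)) * ennreal (\<gamma>\<^sup>2) + ennreal (2 * (v - u)\<^sup>2) * I"
  proof -
    have 1: "ennreal (2 * \<gamma>\<^sup>2) * ennreal (v - u) = ennreal (2 * (v - u)) * ennreal (\<gamma>\<^sup>2)"
      using uv by (subst (1 2) ennreal_mult[symmetric]) (auto simp: mult_ac)
    have 2: "ennreal (2 * (v - u)) * ennreal (v - u) = ennreal (2 * (v - u)\<^sup>2)"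
      using uv by (subst ennreal_mult[symmetric]) (auto simp: power2_eq_square mult_ac)
    show ?thesis by (simp only: distrib_right 1) (simp only: 2[symmetric] mult_ac)
  qed
  finally show ?thesis unfolding I_def .
qed

subsection \<open>Regions between two graphs\<close>

definition frame_map :: "(real^'m \<Rightarrow> real^'n) \<Rightarrow> real^'n \<Rightarrow> (real^'m) \<times> real \<Rightarrow> real^'n" where
  "frame_map E n p = E (fst p) + snd p *\<^sub>R n"

lemma graph_map_eq_frame_map: "graph_map a E n \<zeta> s = a + frame_map E n (s, \<zeta> s)"
  by (simp add: graph_map_def frame_map_def add.assoc)

lemma linear_frame_map: "planar_frame E m n \<Longrightarrow> linear (frame_map E n)"
  unfolding planar_frame_def frame_map_def
  by (intro linearI) (auto simp: linear_add linear_scale algebra_simps)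

lemma norm_frame_map:
  assumes "planar_frame E m n"
  shows "norm (frame_map E n p) = norm p"
proof -
  obtain s t where p: "p = (s, t)" by (cases p)
  have "(norm (E s + t *\<^sub>R n))\<^sup>2 = (norm (E s))\<^sup>2 + 2 * t * (n \<bullet> E s) + t\<^sup>2 * (norm n)\<^sup>2"
    unfolding power2_norm_eq_inner
    by (simp add: inner_add_left inner_add_right inner_commute power2_eq_square)
  also have "\<dots> = (norm p)\<^sup>2"
    using assms by (simp add: planar_frame_def p norm_prod_def)
  finally show ?thesis by (simp add: p frame_map_def)
qed

lemma dist_frame_map:
  assumes "planar_frame E m n"
  shows "dist (a + frame_map E n p) (a + frame_map E n q) = dist p q"
  using norm_frame_map[OF assms, of "p - q"] linear_diff[OF linear_frame_map[OF assms]]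
  by (simp add: dist_norm)

lemma inj_frame_map: "planar_frame E m n \<Longrightarrow> a + frame_map E n p = a + frame_map E n q \<longleftrightarrow> p = q"
  using dist_frame_map[of E m n a p q] by (metis dist_eq_0_iff)

lemma surj_frame_map:
  fixes E :: "real^'m \<Rightarrow> real^'n"
  assumes "planar_frame E m n" "CARD('n) = CARD('m) + 1"
  shows "surj (frame_map E n)"
proof -
  have lin: "linear (frame_map E n)" by (rule linear_frame_map[OF assms(1)])
  have inj: "inj (frame_map E n)"
    using inj_frame_map[OF assms(1), of 0] by (auto simp: inj_def)
  have "dim (range (frame_map E n)) = dim (UNIV :: ((real^'m) \<times> real) set)"
    using inj by (intro dim_image_eq[OF lin]) (auto intro: inj_on_subset)
  also have "\<dots> = DIM(real^'n)" using assms(2) by simp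
  finally have "span (range (frame_map E n)) = UNIV" by (simp only: dim_eq_full)
  moreover have "span (range (frame_map E n)) = range (frame_map E n)"
    using linear_subspace_image[OF lin subspace_UNIV] by (simp add: span_eq_iff)
  ultimately show ?thesis by simp
qed

lemma continuous_frame_map:
  assumes "planar_frame E m n"
  shows "continuous_on S (\<lambda>p. a + frame_map E n p)"
  by (intro continuous_intros linear_continuous_on linear_conv_bounded_linear[THEN iffD1]
      linear_frame_map[OF assms])

text \<open>
  Every vertical line through a point of \<open>V\<close> leaves \<open>V\<close> in both directions, so the point lies
  between the two graphs; conversely the region between them is connected and misses the frontier.
\<close>

lemma bounded_region_between_graphs:
  fixes V :: "('a::euclidean_space \<times> real) set"
  assumes "open V" "bounded V" "V \<noteq> {}"
    and fr: "frontier V \<subseteq> {(s, t). s \<in> C \<and> (t = 0 \<or> t = \<zeta> s)}"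
    and cont: "continuous_on C \<zeta>" and conn: "connected (interior C)"
    and nz: "\<And>s. s \<in> interior C \<Longrightarrow> \<zeta> s \<noteq> 0"
  shows "V = {(s, t). s \<in> interior C \<and> t \<in> open_segment 0 (\<zeta> s)}"
proof
  have exit: "\<exists>t'\<in>I. (s, t') \<in> frontier V"
    if "(s, t) \<in> V" "t \<in> I" "connected I" "\<not> bounded I" for s t I
  proof -
    have "connected (Pair s ` I)"
      using that by (intro connected_continuous_image continuous_intros)
    moreover have "Pair s ` I - V \<noteq> {}"
    proof
      assume "Pair s ` I - V = {}"
      then have "bounded (Pair s ` I)" using \<open>bounded V\<close> by (auto intro: bounded_subset)
      then have "bounded (snd ` Pair s ` I)" by (rule bounded_snd)
      then show False using that by (simp add: image_image)
    qed
    ultimately have "Pair s ` I \<inter> frontier V \<noteq> {}"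
      using that by (intro connected_Int_frontier) auto
    then show ?thesis by auto
  qed
  have disj: "V \<inter> frontier V = {}" using \<open>open V\<close> by (auto simp: frontier_def interior_open)
  have between: "s \<in> C \<and> t \<in> open_segment 0 (\<zeta> s)" if st: "(s, t) \<in> V" for s t
  proof -
    have "\<not> bounded {t..}"
    proof
      assume "bounded {t..}"
      then obtain B where "\<And>x. x \<in> {t..} \<Longrightarrow> \<bar>x\<bar> \<le> B" by (auto simp: bounded_iff)
      from this[of "max t (B + 1)"] show False by auto
    qed
    moreover have "\<not> bounded {..t}"
    proof
      assume "bounded {..t}"
      then obtain B where "\<And>x. x \<in> {..t} \<Longrightarrow> \<bar>x\<bar> \<le> B" by (auto simp: bounded_iff)
      from this[of "min t (- B - 1)"] show False by auto
    qed
    ultimately obtain t1 t2 where t1: "t \<le> t1" "(s, t1) \<in> frontier V" and t2: "t2 \<le> t" "(s, t2) \<in> frontier V"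
      using exit[OF st, of "{t..}"] exit[OF st, of "{..t}"] by auto
    have "t1 \<noteq> t" "t2 \<noteq> t" using st t1 t2 disj by auto
    then show ?thesis
      using t1 t2 fr by (fastforce simp: open_segment_eq_real_ivl)
  qed
  have "open (fst ` V)" using \<open>open V\<close> by (rule open_image_fst)
  then have "fst ` V \<subseteq> interior C" using between by (intro interior_maximal) auto
  then show sub: "V \<subseteq> {(s, t). s \<in> interior C \<and> t \<in> open_segment 0 (\<zeta> s)}"
    using between by (force simp: subset_iff)
  let ?U = "{(s, t). s \<in> interior C \<and> t \<in> open_segment 0 (\<zeta> s)}"
  have "?U = (\<lambda>(s, \<tau>). (s, \<tau> * \<zeta> s)) ` (interior C \<times> {0<..<1})"
  proof safe
    fix s t assume st: "s \<in> interior C" "t \<in> open_segment 0 (\<zeta> s)"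
    then obtain \<tau> where "0 < \<tau>" "\<tau> < 1" "t = \<tau> * \<zeta> s" by (auto simp: in_segment)
    then show "(s, t) \<in> (\<lambda>(s, \<tau>). (s, \<tau> * \<zeta> s)) ` (interior C \<times> {0<..<1})"
      using st by force
  next
    fix s and \<tau> :: real assume "s \<in> interior C" "\<tau> \<in> {0<..<1}"
    then show "\<tau> * \<zeta> s \<in> open_segment 0 (\<zeta> s)" using nz by (force simp: in_segment)
  qed
  moreover have "connected ((\<lambda>(s, \<tau>). (s, \<tau> * \<zeta> s)) ` (interior C \<times> {0<..<1::real}))"
  proof (rule connected_continuous_image)
    have "continuous_on (interior C \<times> {0<..<1::real}) (\<lambda>p. \<zeta> (fst p))"
      by (rule continuous_on_compose2[OF continuous_on_subset[OF cont interior_subset]])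
        (auto intro: continuous_intros)
    then show "continuous_on (interior C \<times> {0<..<1::real}) (\<lambda>(s, \<tau>). (s, \<tau> * \<zeta> s))"
      unfolding split_beta by (intro continuous_intros)
    show "connected (interior C \<times> {0<..<1::real})" by (intro connected_Times conn) simp
  qed
  ultimately have "connected ?U" by simp
  moreover have "?U \<inter> frontier V = {}"
  proof -
    have "t \<noteq> 0 \<and> t \<noteq> \<zeta> s" if "t \<in> open_segment 0 (\<zeta> s)" for s t
      using that by (auto simp: open_segment_def)
    then show ?thesis using fr by blast
  qed
  moreover have "?U \<inter> V \<noteq> {}" using sub \<open>V \<noteq> {}\<close> by blast
  ultimately have "?U - V = {}" using connected_Int_frontier[of ?U V] by blast
  then show "?U \<subseteq> V" by blast
qed

text \<open>
  Near \<open>(s\<^sub>0, \<zeta> s\<^sub>0)\<close>, any point of the region is joined to \<open>(s\<^sub>0, t*)\<close>, with a fixed \<open>t*\<close> slightly inside,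
  by a short vertical segment followed by a short horizontal one.
\<close>

lemma segment_lipschitz_limit_at_graph:
  fixes \<psi> :: "'a::euclidean_space \<times> real \<Rightarrow> real" and S :: "'a set" and \<zeta> :: "'a \<Rightarrow> real"
  defines "V \<equiv> {(s, t). s \<in> S \<and> t \<in> open_segment 0 (\<zeta> s)}"
  assumes "open S" "continuous_on S \<zeta>" "s\<^sub>0 \<in> S" "\<zeta> s\<^sub>0 \<noteq> 0"
    and lip: "\<And>p q. closed_segment p q \<subseteq> V \<Longrightarrow> \<bar>\<psi> p - \<psi> q\<bar> \<le> L * norm (p - q)"
    and "L \<ge> 0"
  obtains l where "(\<psi> \<longlongrightarrow> l) (at (s\<^sub>0, \<zeta> s\<^sub>0) within V)"
proof -
  let ?F = "at (s\<^sub>0, \<zeta> s\<^sub>0) within V"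
  define z where "z = \<zeta> s\<^sub>0"
  have near: "\<exists>c. eventually (\<lambda>p. \<bar>\<psi> p - c\<bar> < e) ?F" if "e > 0" for e
  proof -
    define \<delta> where "\<delta> = min (\<bar>z\<bar> / 4) (e / (5 * (L + 1)))"
    have \<delta>: "\<delta> > 0" "\<delta> \<le> \<bar>z\<bar> / 4" "4 * L * \<delta> < e"
    proof -
      show "\<delta> > 0" using that \<open>\<zeta> s\<^sub>0 \<noteq> 0\<close> \<open>L \<ge> 0\<close> by (simp add: \<delta>_def z_def)
      show "\<delta> \<le> \<bar>z\<bar> / 4" unfolding \<delta>_def by (rule min.cobounded1)
      have "4 * L * \<delta> \<le> 4 * L * (e / (5 * (L + 1)))"
        using \<open>L \<ge> 0\<close> by (intro mult_left_mono) (auto simp: \<delta>_def)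
      also have "\<dots> < e" using \<open>L \<ge> 0\<close> \<open>e > 0\<close> by (simp add: divide_simps)
      finally show "4 * L * \<delta> < e" .
    qed
    define t' where "t' = z - 2 * \<delta> * sgn z"
    have "isCont \<zeta> s\<^sub>0"
      using \<open>open S\<close> \<open>continuous_on S \<zeta>\<close> \<open>s\<^sub>0 \<in> S\<close> by (simp add: continuous_on_eq_continuous_at)
    then obtain \<eta>1 where \<eta>1: "\<eta>1 > 0" "\<And>s. dist s s\<^sub>0 < \<eta>1 \<Longrightarrow> \<bar>\<zeta> s - z\<bar> < \<delta>"
      using \<delta>(1) unfolding continuous_at_eps_delta z_def dist_real_def by blast
    obtain \<eta>2 where \<eta>2: "\<eta>2 > 0" "ball s\<^sub>0 \<eta>2 \<subseteq> S"
      using \<open>open S\<close> \<open>s\<^sub>0 \<in> S\<close> open_contains_ball by blast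
    define \<eta> where "\<eta> = min \<delta> (min \<eta>1 \<eta>2)"
    have \<eta>: "\<eta> > 0" "\<eta> \<le> \<delta>" using \<eta>1 \<eta>2 \<delta> by (auto simp: \<eta>_def)
    have S: "s \<in> S" "t' \<in> open_segment 0 (\<zeta> s)" if "dist s s\<^sub>0 < \<eta>" for s
    proof -
      show "s \<in> S" using that \<eta>2 by (auto simp: \<eta>_def dist_commute subset_iff)
      have "\<bar>\<zeta> s - z\<bar> < \<delta>" using \<eta>1(2)[of s] that by (auto simp: \<eta>_def)
      then show "t' \<in> open_segment 0 (\<zeta> s)"
        using \<delta>(1,2) by (cases "z > 0"; cases "z < 0") (auto simp: open_segment_eq_real_ivl t'_def)
    qed
    have "\<bar>\<psi> p - \<psi> (s\<^sub>0, t')\<bar> < e" if p: "p \<in> V" "dist p (s\<^sub>0, z) < \<eta>" for p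
    proof -
      obtain s t where st: "p = (s, t)" "s \<in> S" "t \<in> open_segment 0 (\<zeta> s)" using p by (auto simp: V_def)
      have ds: "dist s s\<^sub>0 < \<eta>" and dt: "\<bar>t - z\<bar> < \<eta>"
        using p(2) dist_fst_le[of p "(s\<^sub>0, z)"] dist_snd_le[of p "(s\<^sub>0, z)"]
        by (auto simp: st dist_real_def)
      have "\<bar>\<psi> (s, t) - \<psi> (s, t')\<bar> \<le> L * norm ((s, t) - (s, t'))"
      proof (rule lip)
        have "closed_segment (s, t) (s, t') \<subseteq> {s} \<times> open_segment 0 (\<zeta> s)"
          using st S(2)[OF ds] by (intro closed_segment_subset convex_Times convex_open_segment) auto
        then show "closed_segment (s, t) (s, t') \<subseteq> V" using st by (auto simp: V_def)
      qed
      also have "\<dots> \<le> L * (3 * \<delta>)"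
        using dt \<eta> \<delta> \<open>L \<ge> 0\<close> by (intro mult_left_mono) (auto simp: t'_def abs_mult sgn_if abs_if split: if_splits)
      finally have v: "\<bar>\<psi> (s, t) - \<psi> (s, t')\<bar> \<le> L * (3 * \<delta>)" .
      have "\<bar>\<psi> (s, t') - \<psi> (s\<^sub>0, t')\<bar> \<le> L * norm ((s, t') - (s\<^sub>0, t'))"
      proof (rule lip)
        have "closed_segment (s, t') (s\<^sub>0, t') \<subseteq> ball s\<^sub>0 \<eta> \<times> {t'}"
          using ds \<eta> by (intro closed_segment_subset convex_Times) (auto simp: dist_commute)
        then show "closed_segment (s, t') (s\<^sub>0, t') \<subseteq> V"
          using S by (auto simp: V_def dist_commute subset_iff)
      qed
      also have "\<dots> \<le> L * \<delta>"
        using ds \<eta> \<open>L \<ge> 0\<close> by (intro mult_left_mono) (auto simp: dist_norm)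
      finally show ?thesis using v \<delta>(3) by (simp add: st(1))
    qed
    then have "eventually (\<lambda>p. \<bar>\<psi> p - \<psi> (s\<^sub>0, t')\<bar> < e) ?F"
      unfolding eventually_at z_def[symmetric] using \<eta>(1) by blast
    then show ?thesis ..
  qed
  have "cauchy_filter (filtermap \<psi> ?F)"
    unfolding cauchy_filter_metric_filtermap
  proof (intro allI impI)
    fix e :: real assume "e > 0"
    then obtain c where "eventually (\<lambda>p. \<bar>\<psi> p - c\<bar> < e / 2) ?F" using near[of "e / 2"] by auto
    moreover have "dist (\<psi> x) (\<psi> y) < e" if "\<bar>\<psi> x - c\<bar> < e / 2" "\<bar>\<psi> y - c\<bar> < e / 2" for x y
      using that unfolding dist_real_def by linarith
    ultimately show "\<exists>P. eventually P ?F \<and> (\<forall>x y. P x \<and> P y \<longrightarrow> dist (\<psi> x) (\<psi> y) < e)"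
      by blast
  qed
  moreover have "complete (UNIV :: real set)" by (rule complete_UNIV)
  ultimately obtain l where "filtermap \<psi> ?F \<le> nhds l \<or> ?F = bot"
    unfolding complete_uniform by (metis UNIV_I filtermap_bot_iff principal_UNIV top_greatest)
  then show ?thesis using that by (auto simp: filterlim_def)
qed

subsection \<open>Functions that are Lipschitz along segments\<close>

definition line_deriv :: "('a::real_normed_vector \<Rightarrow> real) \<Rightarrow> 'a \<Rightarrow> 'a \<Rightarrow> real" where
  "line_deriv f v x =
     lim (\<lambda>k. (f (x + inverse (real (Suc k)) *\<^sub>R v) - f x) /\<^sub>R inverse (real (Suc k)))"

lemma line_deriv_measurable [measurable]:
  fixes f :: "'a::euclidean_space \<Rightarrow> real"
  assumes [measurable]: "f \<in> borel_measurable borel"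
  shows "line_deriv f v \<in> borel_measurable borel"
  unfolding line_deriv_def by measurable

lemma line_deriv_eq:
  assumes "(f has_derivative D) (at x)"
  shows "line_deriv f v x = D v"
proof -
  have "filterlim (\<lambda>k. inverse (real (Suc k))) (at 0) sequentially"
    using LIMSEQ_inverse_real_of_nat by (simp add: filterlim_at)
  from filterlim_compose[OF directional_difference_quotient[OF assms] this]
  show ?thesis unfolding line_deriv_def by (rule limI)
qed

lemma GDERIV_unique:
  assumes "GDERIV f x :> D" "GDERIV f x :> D'"
  shows "D = D'"
proof -
  have "(\<lambda>h. h \<bullet> D) = (\<lambda>h. h \<bullet> D')"
    using assms unfolding gderiv_def by (rule has_derivative_unique)
  then show ?thesis by (metis inner_commute vector_eq_rdot)
qed

lemma grad_eq: "GDERIV f x :> D \<Longrightarrow> grad f x = D"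
  unfolding grad_def using GDERIV_unique by blast

lemma has_derivative_grad:
  assumes "f differentiable at x"
  shows "(f has_derivative (\<lambda>h. h \<bullet> grad f x)) (at x)"
proof -
  obtain D where D: "(f has_derivative D) (at x)" using assms by (auto simp: differentiable_def)
  have "D h = h \<bullet> (\<Sum>b\<in>Basis. D b *\<^sub>R b)" for h
  proof -
    have "D h = D (\<Sum>b\<in>Basis. (h \<bullet> b) *\<^sub>R b)" by (simp add: euclidean_representation)
    also have "\<dots> = (\<Sum>b\<in>Basis. (h \<bullet> b) * D b)"
      using has_derivative_linear[OF D] by (simp add: linear_sum linear_scale)
    finally show ?thesis by (simp add: inner_sum_right mult.commute)
  qed
  then have "D = (\<lambda>h. h \<bullet> (\<Sum>b\<in>Basis. D b *\<^sub>R b))" by blast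
  then have "GDERIV f x :> (\<Sum>b\<in>Basis. D b *\<^sub>R b)"
    using D unfolding gderiv_def by metis
  then show ?thesis using grad_eq unfolding gderiv_def by metis
qed

lemma norm_grad_le:
  assumes "f differentiable at x" "open S" "x \<in> S" "\<And>y. y \<in> S \<Longrightarrow> \<bar>f y - f x\<bar> \<le> L * norm (y - x)" "L \<ge> 0"
  shows "norm (grad f x) \<le> L"
proof -
  have "norm (grad f x \<bullet> grad f x) \<le> L * norm (grad f x)"
    by (rule has_derivative_norm_le[OF has_derivative_grad[OF assms(1)] assms(2,3)]) (use assms(4) in simp)
  then have "norm (grad f x) * norm (grad f x) \<le> L * norm (grad f x)"
    by (simp add: power2_norm_eq_inner[symmetric] power2_eq_square)
  then show ?thesis using \<open>L \<ge> 0\<close> by (cases "grad f x = 0") auto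
qed

lemma negligible_obtain_lborel_null:
  assumes "negligible (N :: 'a::euclidean_space set)"
  obtains N' where "N' \<in> null_sets lborel" "N \<subseteq> N'"
  using assms unfolding negligible_iff_null_sets null_sets_completion_iff2 by blast

lemma nn_integral_eq_lebesgue_integral:
  fixes f g :: "'a::euclidean_space \<Rightarrow> real"
  assumes g: "g \<in> borel_measurable borel" and N: "negligible N" "\<And>x. x \<notin> N \<Longrightarrow> f x = g x"
    and "\<And>x. f x \<ge> 0" and S: "bounded S" "\<And>x. x \<notin> N \<Longrightarrow> x \<in> S \<Longrightarrow> f x \<le> B" "\<And>x. x \<notin> S \<Longrightarrow> f x = 0"
  shows "(\<integral>\<^sup>+x. ennreal (f x) \<partial>lborel) = ennreal (\<integral>x. f x \<partial>lebesgue)"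
proof -
  have notN: "AE x in lebesgue. x \<notin> N"
    using N(1) by (simp add: negligible_iff_null_sets AE_not_in)
  have "AE x in lebesgue. g x = f x" using notN N(2) by auto
  then have f: "f \<in> borel_measurable lebesgue"
    using borel_measurable_AE[of g f] measurable_completion[of g lborel borel] g by auto
  obtain a b where ab: "S \<subseteq> cbox a b" using bounded_subset_cbox_symmetric[OF S(1)] by metis
  have "integrable lebesgue f"
  proof (rule integrableI_bounded_set[where A = "cbox a b" and B = "max B 0"])
    show "AE x in lebesgue. x \<in> cbox a b \<longrightarrow> norm (f x) \<le> max B 0"
      using notN by eventually_elim (metis S(2,3) abs_of_nonneg assms(4) max.coboundedI1 max.coboundedI2 order_refl real_norm_def)
    show "emeasure lebesgue (cbox a b) < \<infinity>" using emeasure_lborel_cbox_finite by simp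
  qed (use f ab S(3) in auto)
  then have "(\<integral>\<^sup>+x. ennreal (f x) \<partial>lebesgue) = ennreal (\<integral>x. f x \<partial>lebesgue)"
    using assms(4) by (intro nn_integral_eq_integral) auto
  then show ?thesis by (simp add: nn_integral_completion)
qed

lemma lebesgue_integral_le_nn_integral:
  fixes f :: "'a::euclidean_space \<Rightarrow> real"
  assumes "\<And>x. f x \<ge> 0"
  shows "ennreal (\<integral>x. f x \<partial>lebesgue) \<le> (\<integral>\<^sup>+x. ennreal (f x) \<partial>lborel)"
proof (cases "integrable lebesgue f")
  case True
  then show ?thesis
    using nn_integral_eq_integral[OF True] assms by (simp add: nn_integral_completion)
qed (simp add: not_integrable_integral_eq)

locale segment_lipschitz =
  fixes P :: "(real^'n) set" and \<phi> :: "real^'n \<Rightarrow> real" and L B :: real and N :: "(real^'n) set"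
  assumes open_P: "open P" and bounded_P: "bounded P"
    and lip: "\<And>x y. closed_segment x y \<subseteq> P \<Longrightarrow> \<bar>\<phi> x - \<phi> y\<bar> \<le> L * norm (x - y)"
    and L_nonneg: "L \<ge> 0"
    and bound: "\<And>x. x \<in> P \<Longrightarrow> \<bar>\<phi> x\<bar> \<le> B"
    and negligible_N: "negligible N"
    and diff: "\<And>x. x \<in> P - N \<Longrightarrow> \<phi> differentiable at x"
begin

definition \<phi>\<^sub>0 :: "real^'n \<Rightarrow> real" where "\<phi>\<^sub>0 x = indicator P x * \<phi> x"

lemma \<phi>\<^sub>0_eq: "x \<in> P \<Longrightarrow> \<phi>\<^sub>0 x = \<phi> x" by (simp add: \<phi>\<^sub>0_def)

lemma locally_lipschitz:
  assumes "x \<in> P"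
  shows "\<exists>r>0. ball x r \<subseteq> P \<and> (\<forall>y\<in>ball x r. \<bar>\<phi> y - \<phi> x\<bar> \<le> L * norm (y - x))"
proof -
  obtain r where r: "r > 0" "ball x r \<subseteq> P" using open_P assms open_contains_ball by blast
  have "\<bar>\<phi> y - \<phi> x\<bar> \<le> L * norm (y - x)" if "y \<in> ball x r" for y
  proof (rule lip)
    have "closed_segment y x \<subseteq> ball x r" using that r by (intro closed_segment_subset) auto
    then show "closed_segment y x \<subseteq> P" using r by blast
  qed
  then show ?thesis using r by blast
qed

lemma continuous_on_\<phi>: "continuous_on P \<phi>"
proof -
  have "isCont \<phi> x" if x: "x \<in> P" for x
  proof -
    obtain r where r: "r > 0" "ball x r \<subseteq> P"
      "\<And>y. y \<in> ball x r \<Longrightarrow> \<bar>\<phi> y - \<phi> x\<bar> \<le> L * norm (y - x)"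
      using locally_lipschitz[OF x] by metis
    have "((\<lambda>y. \<phi> y - \<phi> x) \<longlongrightarrow> 0) (at x)"
    proof (rule Lim_null_comparison)
      show "eventually (\<lambda>y. norm (\<phi> y - \<phi> x) \<le> L * norm (y - x)) (at x)"
        unfolding eventually_at using r by (intro exI[of _ r]) (auto simp: dist_commute)
      show "((\<lambda>y. L * norm (y - x)) \<longlongrightarrow> 0) (at x)"
        by (auto intro!: tendsto_eq_intros)
    qed
    then show ?thesis unfolding isCont_def by (rule LIM_zero_cancel)
  qed
  then show ?thesis by (simp add: continuous_at_imp_continuous_on)
qed

lemma measurable_\<phi>\<^sub>0 [measurable]: "\<phi>\<^sub>0 \<in> borel_measurable borel"
  using borel_measurable_continuous_on_indicator[OF _ continuous_on_\<phi>] open_P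
  unfolding \<phi>\<^sub>0_def[abs_def] by simp

lemma has_derivative_\<phi>\<^sub>0:
  assumes "x \<in> P - N"
  shows "(\<phi>\<^sub>0 has_derivative (\<lambda>h. h \<bullet> grad \<phi> x)) (at x)"
  by (rule has_derivative_transform_within_open[OF has_derivative_grad[OF diff[OF assms]] open_P])
    (use assms in \<open>auto simp: \<phi>\<^sub>0_eq\<close>)

lemma line_deriv_\<phi>\<^sub>0: "x \<in> P - N \<Longrightarrow> line_deriv \<phi>\<^sub>0 v x = v \<bullet> grad \<phi> x"
  by (rule line_deriv_eq[OF has_derivative_\<phi>\<^sub>0])

lemma norm_grad_\<phi>_le:
  assumes "x \<in> P - N"
  shows "norm (grad \<phi> x) \<le> L"
proof -
  have "x \<in> P" using assms by simp
  then obtain r where r: "r > 0" "ball x r \<subseteq> P"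
    "\<And>y. y \<in> ball x r \<Longrightarrow> \<bar>\<phi> y - \<phi> x\<bar> \<le> L * norm (y - x)"
    using locally_lipschitz by metis
  then show ?thesis
    using norm_grad_le[OF diff[OF assms] open_ball _ _ L_nonneg, of x r] by simp
qed

lemma nn_integral_grad_square:
  "(\<integral>\<^sup>+x. ennreal ((norm (grad \<phi> x))\<^sup>2) * indicator P x \<partial>lborel) =
     ennreal (LINT x : P | lebesgue. (norm (grad \<phi> x))\<^sup>2)"
proof -
  have "(\<integral>\<^sup>+x. ennreal ((norm (grad \<phi> x))\<^sup>2) * indicator P x \<partial>lborel) =
      (\<integral>\<^sup>+x. ennreal (indicator P x *\<^sub>R (norm (grad \<phi> x))\<^sup>2) \<partial>lborel)"
    by (intro nn_integral_cong) (auto simp: indicator_def)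
  also have "\<dots> = ennreal (\<integral>x. indicator P x *\<^sub>R (norm (grad \<phi> x))\<^sup>2 \<partial>lebesgue)"
  proof (rule nn_integral_eq_lebesgue_integral[where S = P and N = N and B = "L\<^sup>2"])
    show "(\<lambda>x. indicator P x * (\<Sum>b\<in>Basis. (line_deriv \<phi>\<^sub>0 b x)\<^sup>2)) \<in> borel_measurable borel"
      using open_P by (intro borel_measurable_times borel_measurable_sum borel_measurable_power
          line_deriv_measurable measurable_\<phi>\<^sub>0 borel_measurable_indicator) simp
    show "indicator P x *\<^sub>R (norm (grad \<phi> x))\<^sup>2 = indicator P x * (\<Sum>b\<in>Basis. (line_deriv \<phi>\<^sub>0 b x)\<^sup>2)" if "x \<notin> N" for x
    proof (cases "x \<in> P")
      case True
      then have "(\<Sum>b\<in>Basis. (line_deriv \<phi>\<^sub>0 b x)\<^sup>2) = (\<Sum>b\<in>Basis. (grad \<phi> x \<bullet> b)\<^sup>2)"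
        using that by (simp add: line_deriv_\<phi>\<^sub>0 inner_commute)
      also have "\<dots> = (norm (grad \<phi> x))\<^sup>2"
        unfolding norm_eq_sqrt_inner by (subst euclidean_inner) (simp add: power2_eq_square sum_nonneg)
      finally show ?thesis by simp
    qed simp
    show "indicator P x *\<^sub>R (norm (grad \<phi> x))\<^sup>2 \<le> L\<^sup>2" if "x \<notin> N" "x \<in> P" for x
      using norm_grad_\<phi>_le[of x] that by (auto intro: power_mono)
  qed (use bounded_P negligible_N in auto)
  finally show ?thesis by (simp add: set_lebesgue_integral_def)
qed

end

lemma closed_segment_frame_map:
  assumes "planar_frame E m n"
  shows "closed_segment (a + frame_map E n p) (a + frame_map E n q) = (\<lambda>p. a + frame_map E n p) ` closed_segment p q"
  by (simp add: closed_segment_translation closed_segment_linear_image linear_frame_map[OF assms] image_image)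

lemma at_within_open_segment_neq_bot:
  assumes "z \<noteq> (0 :: real)"
  shows "at z within open_segment 0 z \<noteq> bot"
proof -
  have "z islimpt open_segment 0 z"
    using assms by (cases "z > 0")
      (auto simp: open_segment_eq_real_ivl islimpt_greaterThanLessThan1 islimpt_greaterThanLessThan2)
  then show ?thesis by (simp add: trivial_limit_within)
qed

context segment_lipschitz
begin

context
  fixes a n :: "real^'n" and E :: "real^'m \<Rightarrow> real^'n" and m :: "real^'m" and \<zeta> \<gamma> :: "real^'m \<Rightarrow> real"
    and W :: "(real^'n) set" and T :: "(real^'m) \<times> real \<Rightarrow> real^'n"
  defines "T \<equiv> \<lambda>p. a + frame_map E n p"
  assumes frame: "planar_frame E m n"
    and W: "open W" "W \<subseteq> P"
    and region: "T -` W = {(s, t). s \<in> box 0 m \<and> t \<in> open_segment 0 (\<zeta> s)}"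
    and cont: "continuous_on (cbox 0 m) \<zeta>" and nz: "\<And>s. s \<in> box 0 m \<Longrightarrow> \<zeta> s \<noteq> 0"
    and trace: "\<And>s. s \<in> box 0 m \<Longrightarrow>
      ((\<lambda>t. \<phi> (T (s, t))) \<longlongrightarrow> \<gamma> s) (at (\<zeta> s) within open_segment 0 (\<zeta> s))"
begin

lemma T_in_W: "T (s, t) \<in> W \<longleftrightarrow> s \<in> box 0 m \<and> t \<in> open_segment 0 (\<zeta> s)"
  using region by (auto simp: set_eq_iff vimage_def)

lemma continuous_T: "continuous_on S T"
  unfolding T_def by (rule continuous_frame_map[OF frame])

lemma measurable_T [measurable]: "T \<in> borel_measurable borel"
  by (intro borel_measurable_continuous_onI continuous_T)

lemma trace_0:
  assumes "s \<in> box 0 m"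
  shows "((\<lambda>t. \<phi>\<^sub>0 (T (s, t))) \<longlongrightarrow> \<gamma> s) (at (\<zeta> s) within open_segment 0 (\<zeta> s))"
proof (rule Lim_transform_eventually[OF trace[OF assms]])
  show "eventually (\<lambda>t. \<phi> (T (s, t)) = \<phi>\<^sub>0 (T (s, t))) (at (\<zeta> s) within open_segment 0 (\<zeta> s))"
    unfolding eventually_at_filter
    by (intro always_eventually allI impI) (metis T_in_W W(2) \<phi>\<^sub>0_eq assms subsetD)
qed

lemma trace_bound:
  assumes "s \<in> box 0 m"
  shows "\<bar>\<gamma> s\<bar> \<le> B"
proof (rule tendsto_upperbound)
  show "((\<lambda>t. \<bar>\<phi> (T (s, t))\<bar>) \<longlongrightarrow> \<bar>\<gamma> s\<bar>) (at (\<zeta> s) within open_segment 0 (\<zeta> s))"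
    by (intro tendsto_rabs trace assms)
  show "eventually (\<lambda>t. \<bar>\<phi> (T (s, t))\<bar> \<le> B) (at (\<zeta> s) within open_segment 0 (\<zeta> s))"
    unfolding eventually_at_filter
    using T_in_W assms W(2) bound by (intro always_eventually) blast
qed (rule at_within_open_segment_neq_bot[OF nz[OF assms]])

lemma trace_measurable: "(\<lambda>s. indicator (box 0 m) s * \<gamma> s) \<in> borel_measurable borel"
proof (rule borel_measurable_LIMSEQ_metric)
  define r where "r k = 1 - inverse (real (Suc (Suc k)))" for k
  let ?\<zeta> = "\<lambda>s. indicator (box 0 m) s *\<^sub>R \<zeta> s"
  have [measurable]: "?\<zeta> \<in> borel_measurable borel"
    using cont by (intro borel_measurable_continuous_on_indicator continuous_on_subset[OF cont box_subset_cbox]) auto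
  have [measurable]: "indicator (box 0 m) \<in> borel_measurable (borel :: (real^'m) measure)"
    by (intro borel_measurable_indicator) auto
  show "(\<lambda>s. indicator (box 0 m) s * \<phi>\<^sub>0 (T (s, r k * ?\<zeta> s))) \<in> borel_measurable borel" for k
    by measurable
  fix s :: "real^'m"
  show "(\<lambda>k. indicator (box 0 m) s * \<phi>\<^sub>0 (T (s, r k * ?\<zeta> s))) \<longlonglongrightarrow> indicator (box 0 m) s * \<gamma> s"
  proof (cases "s \<in> box 0 m")
    case True
    have r: "0 < r k" "r k < 1" for k
      by (auto simp: r_def inverse_less_1_iff)
    have "r \<longlonglongrightarrow> 1 - 0"
      unfolding r_def by (intro tendsto_intros LIMSEQ_Suc[OF LIMSEQ_inverse_real_of_nat])
    then have "(\<lambda>k. r k * \<zeta> s) \<longlonglongrightarrow> 1 * \<zeta> s" by (intro tendsto_intros) simp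
    moreover have "r k * \<zeta> s \<in> open_segment 0 (\<zeta> s)" "r k * \<zeta> s \<noteq> \<zeta> s" for k
      using r[of k] nz[OF True] by (auto simp: in_segment)
    ultimately have "filterlim (\<lambda>k. r k * \<zeta> s) (at (\<zeta> s) within open_segment 0 (\<zeta> s)) sequentially"
      by (simp add: filterlim_at)
    from filterlim_compose[OF trace_0[OF True] this] show ?thesis using True by simp
  qed simp
qed

lemma vertical_estimate:
  assumes s: "s \<in> box 0 m" and ae: "AE t in lborel. T (s, t) \<notin> N"
  shows "(\<integral>\<^sup>+t. ennreal ((\<phi>\<^sub>0 (T (s, t)))\<^sup>2) * indicator W (T (s, t)) \<partial>lborel) \<le>
     ennreal (2 * \<bar>\<zeta> s\<bar>) * ennreal ((\<gamma> s)\<^sup>2) +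
     ennreal (2 * \<bar>\<zeta> s\<bar>\<^sup>2) * (\<integral>\<^sup>+t. ennreal ((line_deriv \<phi>\<^sub>0 n (T (s, t)))\<^sup>2) * indicator W (T (s, t)) \<partial>lborel)"
proof -
  define u where "u = min 0 (\<zeta> s)"
  define v where "v = max 0 (\<zeta> s)"
  have uv: "v - u = \<bar>\<zeta> s\<bar>" by (auto simp: u_def v_def)
  have seg: "open_segment 0 (\<zeta> s) = {u<..<v}"
    by (auto simp: open_segment_eq_real_ivl u_def v_def)
  have W_iff: "T (s, t) \<in> W \<longleftrightarrow> t \<in> {u<..<v}" for t using T_in_W s seg by simp
  have iW: "indicator W (T (s, t)) = (indicator {u<..<v} t :: ennreal)" for t
    using W_iff[of t] by (simp add: indicator_def)
  show ?thesis
    unfolding iW uv[symmetric]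
  proof (rule lipschitz_square_integral_le)
    show "L-lipschitz_on {u<..<v} (\<lambda>t. \<phi>\<^sub>0 (T (s, t)))"
    proof (rule lipschitz_onI)
      fix x y assume xy: "x \<in> {u<..<v}" "y \<in> {u<..<v}"
      have "closed_segment (s, x) (s, y) \<subseteq> {s} \<times> {u<..<v}"
        using xy by (intro closed_segment_subset convex_Times) auto
      then have "closed_segment (T (s, x)) (T (s, y)) \<subseteq> P"
        using W_iff W(2) unfolding T_def closed_segment_frame_map[OF frame] by blast
      from lip[OF this] have "\<bar>\<phi> (T (s, x)) - \<phi> (T (s, y))\<bar> \<le> L * dist (T (s, x)) (T (s, y))"
        by (simp add: dist_norm)
      also have "dist (T (s, x)) (T (s, y)) = dist x y"
        unfolding T_def dist_frame_map[OF frame] by (simp add: dist_Pair_Pair)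
      finally show "dist (\<phi>\<^sub>0 (T (s, x))) (\<phi>\<^sub>0 (T (s, y))) \<le> L * dist x y"
        using xy W_iff W(2) by (simp add: \<phi>\<^sub>0_eq subset_iff dist_real_def)
    qed (rule L_nonneg)
    have [measurable]: "line_deriv \<phi>\<^sub>0 n \<in> borel_measurable borel" by (intro line_deriv_measurable measurable_\<phi>\<^sub>0)
    show "(\<lambda>t. line_deriv \<phi>\<^sub>0 n (T (s, t))) \<in> borel_measurable borel"
      by measurable
    show "AE t in lborel. t \<in> {u<..<v} \<longrightarrow>
        ((\<lambda>t. \<phi>\<^sub>0 (T (s, t))) has_real_derivative line_deriv \<phi>\<^sub>0 n (T (s, t))) (at t)"
      using ae
    proof (eventually_elim, intro impI)
      fix t assume "T (s, t) \<notin> N" "t \<in> {u<..<v}"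
      then have x: "T (s, t) \<in> P - N" using W_iff W(2) by auto
      have "((\<lambda>t. T (s, t)) has_derivative (\<lambda>h. h *\<^sub>R n)) (at t)"
        unfolding T_def frame_map_def by (auto intro!: derivative_eq_intros)
      from has_derivative_compose[OF this has_derivative_\<phi>\<^sub>0[OF x]]
      show "((\<lambda>t. \<phi>\<^sub>0 (T (s, t))) has_real_derivative line_deriv \<phi>\<^sub>0 n (T (s, t))) (at t)"
        by (simp add: line_deriv_\<phi>\<^sub>0[OF x] has_field_derivative_def mult_commute_abs)
    qed
    show "((\<lambda>t. \<phi>\<^sub>0 (T (s, t))) \<longlongrightarrow> \<gamma> s) (at (\<zeta> s) within {u<..<v})"
      using trace_0[OF s] unfolding seg .
    show "at (\<zeta> s) within {u<..<v} \<noteq> bot"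
      using at_within_open_segment_neq_bot[OF nz[OF s]] unfolding seg .
    show "eventually (\<lambda>t. t \<in> {u<..<v}) (at (\<zeta> s) within {u<..<v})"
      by (simp add: eventually_at_filter)
  qed
qed

lemma region_estimate:
  assumes "\<kappa> > 0"
    and \<kappa>: "\<And>F. F \<in> borel_measurable borel \<Longrightarrow> (\<integral>\<^sup>+y. F y \<partial>lborel) = ennreal \<kappa> * (\<integral>\<^sup>+p. F (T p) \<partial>lborel)"
    and d: "\<And>s. s \<in> box 0 m \<Longrightarrow> \<bar>\<zeta> s\<bar> \<le> d" "d \<ge> 0"
  shows "(\<integral>\<^sup>+x. ennreal ((\<phi> x)\<^sup>2) * indicator W x \<partial>lborel) \<le>
     ennreal (2 * d * \<kappa>) * (\<integral>\<^sup>+s. ennreal ((\<gamma> s)\<^sup>2) * indicator (box 0 m) s \<partial>lborel) +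
     ennreal (2 * d\<^sup>2) * (\<integral>\<^sup>+x. ennreal ((norm (grad \<phi> x))\<^sup>2) * indicator P x \<partial>lborel)"
proof -
  define F where "F = (\<lambda>y. ennreal ((\<phi>\<^sub>0 y)\<^sup>2) * indicator W y)"
  define H where "H = (\<lambda>y. ennreal ((line_deriv \<phi>\<^sub>0 n y)\<^sup>2) * indicator W y)"
  define \<Gamma> where "\<Gamma> = (\<lambda>s. ennreal ((indicator (box 0 m) s * \<gamma> s)\<^sup>2))"
  have [measurable]: "W \<in> sets borel" using W by simp
  have [measurable]: "line_deriv \<phi>\<^sub>0 n \<in> borel_measurable borel" by (intro line_deriv_measurable measurable_\<phi>\<^sub>0)
  note [measurable] = trace_measurable
  have F[measurable]: "F \<in> borel_measurable borel" and H[measurable]: "H \<in> borel_measurable borel"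
    and \<Gamma>[measurable]: "\<Gamma> \<in> borel_measurable borel"
    unfolding F_def H_def \<Gamma>_def by measurable
  have fubini: "(\<integral>\<^sup>+y. G y \<partial>lborel) = ennreal \<kappa> * (\<integral>\<^sup>+s. (\<integral>\<^sup>+t. G (T (s, t)) \<partial>lborel) \<partial>lborel)"
    and fubini_meas: "(\<lambda>s. \<integral>\<^sup>+t. G (T (s, t)) \<partial>lborel) \<in> borel_measurable borel"
    if [measurable]: "G \<in> borel_measurable borel" for G
  proof -
    have G: "(\<lambda>p. G (T p)) \<in> borel_measurable (lborel \<Otimes>\<^sub>M lborel)"
      unfolding lborel_prod by simp
    show "(\<lambda>s. \<integral>\<^sup>+t. G (T (s, t)) \<partial>lborel) \<in> borel_measurable borel"
      using lborel.borel_measurable_nn_integral_fst[OF G] by simp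
    have "(\<integral>\<^sup>+p. G (T p) \<partial>lborel) = (\<integral>\<^sup>+p. G (T p) \<partial>(lborel \<Otimes>\<^sub>M lborel))"
      by (simp add: lborel_prod)
    then show "(\<integral>\<^sup>+y. G y \<partial>lborel) = ennreal \<kappa> * (\<integral>\<^sup>+s. (\<integral>\<^sup>+t. G (T (s, t)) \<partial>lborel) \<partial>lborel)"
      using \<kappa>[OF that] lborel.nn_integral_fst[OF G] by simp
  qed
  obtain N' where N': "N' \<in> null_sets lborel" "N \<subseteq> N'"
    using negligible_N by (rule negligible_obtain_lborel_null)
  have [measurable]: "N' \<in> sets borel" using N' by auto
  have "ennreal \<kappa> * (\<integral>\<^sup>+p. indicator N' (T p) \<partial>lborel) = 0"
    using N' by (subst \<kappa>[symmetric]) auto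
  then have "(\<integral>\<^sup>+p. indicator N' (T p) \<partial>lborel) = 0"
    using \<open>\<kappa> > 0\<close> by simp
  then have "AE p in lborel. indicator N' (T p) = (0 :: ennreal)"
    by (subst (asm) nn_integral_0_iff_AE) auto
  then have "AE p in lborel \<Otimes>\<^sub>M lborel. T p \<notin> N"
    unfolding lborel_prod using N'(2) by (auto simp: indicator_def split: if_splits elim!: eventually_mono)
  then have ae: "AE s in lborel. AE t in lborel. T (s, t) \<notin> N"
    by (rule lborel_pair.AE_pair)
  have le: "(\<integral>\<^sup>+t. F (T (s, t)) \<partial>lborel) \<le>
      ennreal (2 * d) * \<Gamma> s + ennreal (2 * d\<^sup>2) * (\<integral>\<^sup>+t. H (T (s, t)) \<partial>lborel)"
    if "AE t in lborel. T (s, t) \<notin> N" for s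
  proof (cases "s \<in> box 0 m")
    case True
    have "(\<integral>\<^sup>+t. F (T (s, t)) \<partial>lborel) \<le> ennreal (2 * \<bar>\<zeta> s\<bar>) * ennreal ((\<gamma> s)\<^sup>2) +
        ennreal (2 * \<bar>\<zeta> s\<bar>\<^sup>2) * (\<integral>\<^sup>+t. H (T (s, t)) \<partial>lborel)"
      using vertical_estimate[OF True that] unfolding F_def H_def .
    also have "\<dots> \<le> ennreal (2 * d) * ennreal ((\<gamma> s)\<^sup>2) + ennreal (2 * d\<^sup>2) * (\<integral>\<^sup>+t. H (T (s, t)) \<partial>lborel)"
      using d(1)[OF True] by (intro add_mono mult_right_mono ennreal_leI mult_left_mono power_mono) auto
    finally show ?thesis using True by (simp add: \<Gamma>_def)
  next
    case False
    then have "F (T (s, t)) = 0" for t using T_in_W by (simp add: F_def)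
    then show ?thesis by simp
  qed
  have "(\<integral>\<^sup>+x. ennreal ((\<phi> x)\<^sup>2) * indicator W x \<partial>lborel) = (\<integral>\<^sup>+y. F y \<partial>lborel)"
    unfolding F_def using W(2) by (intro nn_integral_cong) (auto simp: indicator_def \<phi>\<^sub>0_eq)
  also have "\<dots> = ennreal \<kappa> * (\<integral>\<^sup>+s. (\<integral>\<^sup>+t. F (T (s, t)) \<partial>lborel) \<partial>lborel)" by (rule fubini[OF F])
  also have "\<dots> \<le> ennreal \<kappa> * (\<integral>\<^sup>+s. (ennreal (2 * d) * \<Gamma> s + ennreal (2 * d\<^sup>2) * (\<integral>\<^sup>+t. H (T (s, t)) \<partial>lborel)) \<partial>lborel)"
    using ae by (intro mult_left_mono nn_integral_mono_AE) (auto elim!: eventually_mono intro: le)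
  also have "(\<integral>\<^sup>+s. (ennreal (2 * d) * \<Gamma> s + ennreal (2 * d\<^sup>2) * (\<integral>\<^sup>+t. H (T (s, t)) \<partial>lborel)) \<partial>lborel) =
      ennreal (2 * d) * (\<integral>\<^sup>+s. \<Gamma> s \<partial>lborel) + ennreal (2 * d\<^sup>2) * (\<integral>\<^sup>+s. (\<integral>\<^sup>+t. H (T (s, t)) \<partial>lborel) \<partial>lborel)"
    using fubini_meas[OF H] by (subst nn_integral_add) (auto simp: nn_integral_cmult)
  also have "ennreal \<kappa> * \<dots> = ennreal (2 * d * \<kappa>) * (\<integral>\<^sup>+s. \<Gamma> s \<partial>lborel) +
      ennreal (2 * d\<^sup>2) * (\<integral>\<^sup>+y. H y \<partial>lborel)"
    using d(2) \<open>\<kappa> > 0\<close> ennreal_mult[of "2 * d" \<kappa>]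
    unfolding fubini[OF H] by (simp add: distrib_left mult_ac)
  also have "(\<integral>\<^sup>+s. \<Gamma> s \<partial>lborel) = (\<integral>\<^sup>+s. ennreal ((\<gamma> s)\<^sup>2) * indicator (box 0 m) s \<partial>lborel)"
    unfolding \<Gamma>_def by (intro nn_integral_cong) (auto simp: indicator_def)
  also have "(\<integral>\<^sup>+y. H y \<partial>lborel) \<le> (\<integral>\<^sup>+x. ennreal ((norm (grad \<phi> x))\<^sup>2) * indicator P x \<partial>lborel)"
  proof (rule nn_integral_mono_AE)
    have "AE x in lborel. x \<notin> N" using AE_not_in[OF N'(1)] N'(2) by (auto elim!: eventually_mono)
    then show "AE x in lborel. H x \<le> ennreal ((norm (grad \<phi> x))\<^sup>2) * indicator P x"
    proof eventually_elim
      case (elim x)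
      show ?case
      proof (cases "x \<in> W")
        case True
        then have x: "x \<in> P - N" using elim W by auto
        have "\<bar>n \<bullet> grad \<phi> x\<bar> \<le> norm (grad \<phi> x)"
          using Cauchy_Schwarz_ineq2[of n "grad \<phi> x"] frame by (simp add: planar_frame_def)
        then have "(n \<bullet> grad \<phi> x)\<^sup>2 \<le> (norm (grad \<phi> x))\<^sup>2" by (simp add: abs_le_square_iff[symmetric])
        then show ?thesis using True x by (simp add: H_def line_deriv_\<phi>\<^sub>0[OF x] ennreal_leI)
      qed (simp add: H_def)
    qed
  qed
  finally show ?thesis by (simp add: mult_left_mono add_left_mono)
qed

end
end

subsection \<open>Mesh size and overlap geometry\<close>

lemma finite_mesh_elements: "finite (mesh_elements (\<Xi> :: 'n::finite \<Rightarrow> real list))"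
proof -
  let ?A = "{u :: real^'n. \<forall>i. u $ i \<in> set (\<Xi> i)}"
  have "?A \<subseteq> vec_lambda ` (\<Pi>\<^sub>E i\<in>UNIV. set (\<Xi> i))"
  proof
    fix u assume "u \<in> ?A"
    then have "vec_nth u \<in> (\<Pi>\<^sub>E i\<in>UNIV. set (\<Xi> i))" by auto
    then show "u \<in> vec_lambda ` (\<Pi>\<^sub>E i\<in>UNIV. set (\<Xi> i))" by (metis image_eqI vec_nth_inverse)
  qed
  then have "finite ?A" by (rule finite_subset) (intro finite_imageI finite_PiE; simp)
  then have "finite ((\<lambda>(u, v). cbox u v) ` (?A \<times> ?A))" by simp
  then show ?thesis by (rule rev_finite_subset) (auto simp: mesh_elements_def)
qed

lemma mesh_elements_nonempty:
  fixes \<Xi> :: "'n::finite \<Rightarrow> real list"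
  assumes "\<And>i. open_knot_vector p (\<Xi> i)"
  shows "mesh_elements \<Xi> \<noteq> {}"
proof -
  define v :: "real^'n" where "v = (\<chi> i. Min {k \<in> set (\<Xi> i). 0 < k})"
  have knots: "0 \<in> set (\<Xi> i)" "1 \<in> set (\<Xi> i)" for i
    using assms[of i] count_notin[of 0 "\<Xi> i"] count_notin[of 1 "\<Xi> i"] by (auto simp: open_knot_vector_def)
  have v: "v $ i \<in> {k \<in> set (\<Xi> i). 0 < k}" for i
    unfolding v_def vec_lambda_beta by (rule Min_in) (use knots[of i] in force)+
  have "k \<notin> {0<..<v $ i}" if "k \<in> set (\<Xi> i)" for k i
    using that by (auto simp: v_def not_less intro!: Min_le)
  then have "cbox 0 v \<in> mesh_elements \<Xi>"
    unfolding mesh_elements_def using v knots by (intro CollectI exI[of _ 0] exI[of _ v]) auto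
  then show ?thesis by blast
qed

lemma mesh_size_bounds:
  fixes \<Xi>\<^sub>1 \<Xi>\<^sub>2 :: "'n::finite \<Rightarrow> real list"
  assumes "\<And>i. open_knot_vector p (\<Xi>\<^sub>1 i)" "\<And>i. open_knot_vector p (\<Xi>\<^sub>2 i)"
  shows "0 \<le> mesh_size \<Xi>\<^sub>1 \<Xi>\<^sub>2" "mesh_size \<Xi>\<^sub>1 \<Xi>\<^sub>2 \<le> diameter (cbox 0 1 :: (real^'n) set)"
proof -
  have D: "0 \<le> diameter D \<and> diameter D \<le> diameter (cbox 0 1 :: (real^'n) set)"
    if D: "D \<in> mesh_elements \<Xi>" and knots: "\<And>i. open_knot_vector p (\<Xi> i)"
    for \<Xi> :: "'n \<Rightarrow> real list" and D
  proof -
    obtain u v where uv: "D = cbox u v" "\<And>i. u $ i \<in> set (\<Xi> i)" "\<And>i. v $ i \<in> set (\<Xi> i)"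
      using D by (auto simp: mesh_elements_def)
    have "set (\<Xi> i) \<subseteq> {0..1}" for i using knots[of i] by (simp add: open_knot_vector_def)
    then have "0 \<le> u $ i" "v $ i \<le> 1" for i using uv(2,3)[of i] by (meson atLeastAtMost_iff subsetD)+
    then have "D \<subseteq> cbox 0 1" unfolding uv(1) by (auto simp: mem_box_cart) (meson order_trans)+
    moreover have "bounded D" unfolding uv(1) by (rule bounded_cbox)
    ultimately show ?thesis by (intro conjI diameter_ge_0 diameter_subset bounded_cbox)
  qed
  have M: "0 \<le> Max (diameter ` mesh_elements \<Xi>) \<and>
      Max (diameter ` mesh_elements \<Xi>) \<le> diameter (cbox 0 1 :: (real^'n) set)"
    if knots: "\<And>i. open_knot_vector p (\<Xi> i)" for \<Xi> :: "'n \<Rightarrow> real list"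
  proof -
    have "Max (diameter ` mesh_elements \<Xi>) \<in> diameter ` mesh_elements \<Xi>"
      using finite_mesh_elements mesh_elements_nonempty[of p \<Xi>, OF knots] by (intro Max_in) auto
    then show ?thesis using D knots by auto
  qed
  show "0 \<le> mesh_size \<Xi>\<^sub>1 \<Xi>\<^sub>2" "mesh_size \<Xi>\<^sub>1 \<Xi>\<^sub>2 \<le> diameter (cbox 0 1 :: (real^'n) set)"
    unfolding mesh_size_def using M[of \<Xi>\<^sub>1] M[of \<Xi>\<^sub>2] assms by (simp_all add: le_max_iff_disj)
qed

lemma frontier_vimage_subset:
  fixes T :: "'a::topological_space \<Rightarrow> 'b::topological_space"
  assumes "continuous_on UNIV T" "open W"
  shows "frontier (T -` W) \<subseteq> T -` frontier W"
proof
  fix x assume x: "x \<in> frontier (T -` W)"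
  have "T ` closure (T -` W) \<subseteq> closure W"
    by (rule image_closure_subset) (use assms in \<open>auto intro: continuous_on_subset closure_subset[THEN subsetD]\<close>)
  moreover have "open (T -` W)" using assms by (simp add: continuous_on_open_vimage)
  ultimately show "x \<in> T -` frontier W"
    using x \<open>open W\<close> by (auto simp: frontier_def interior_open)
qed

locale graph_overlap_patches =
  fixes \<Omega> \<Omega>\<^sub>1 \<Omega>\<^sub>2 P\<^sub>1 P\<^sub>2 :: "(real^'n) set"
    and a n :: "real^'n" and E :: "real^'m \<Rightarrow> real^'n" and m :: "real^'m" and \<zeta> :: "real^'m \<Rightarrow> real"
  assumes card: "CARD('n) = CARD('m) + 1"
    and bounded_\<Omega>: "bounded \<Omega>"
    and frame: "planar_frame E m n"
    and interface: "interface \<Omega>\<^sub>1 \<Omega>\<^sub>2 = face a E m"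
    and overlap: "graph_overlap \<Omega> \<Omega>\<^sub>1 a E m n P\<^sub>1 P\<^sub>2 \<zeta>"
begin

definition T :: "(real^'m) \<times> real \<Rightarrow> real^'n" where
  "T p = a + frame_map E n p"

lemma T_eq: "T = (\<lambda>p. a + frame_map E n p)" by (simp add: T_def fun_eq_iff)

lemma graph_map_eq_T: "graph_map a E n \<zeta> s = T (s, \<zeta> s)"
  by (simp add: graph_map_eq_frame_map T_def)

lemma continuous_T: "continuous_on S T"
  unfolding T_eq by (rule continuous_frame_map[OF frame])

lemma dist_T: "dist (T p) (T q) = dist p q"
  unfolding T_def by (rule dist_frame_map[OF frame])

lemma surj_T: "surj T"
proof (rule surjI)
  fix y
  show "T (inv (frame_map E n) (y - a)) = y"
    by (simp add: T_def surj_f_inv_f[OF surj_frame_map[OF frame card]])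
qed

lemma patches:
  "open P\<^sub>1" "open P\<^sub>2" "bounded P\<^sub>2" "bounded (P\<^sub>1 \<inter> P\<^sub>2)"
  "frontier (P\<^sub>1 \<inter> P\<^sub>2) = closure (overlap_face P\<^sub>1 P\<^sub>2) \<union> closure (overlap_face P\<^sub>2 P\<^sub>1)"
proof -
  have *: "overlapping_patches \<Omega> P\<^sub>1 P\<^sub>2" using overlap unfolding graph_overlap_def by blast
  then show "open P\<^sub>1" "open P\<^sub>2" "frontier (P\<^sub>1 \<inter> P\<^sub>2) = closure (overlap_face P\<^sub>1 P\<^sub>2) \<union> closure (overlap_face P\<^sub>2 P\<^sub>1)"
    by (auto simp: overlapping_patches_def)
  have "P\<^sub>2 \<subseteq> closure \<Omega>" using * closure_subset by (auto simp: overlapping_patches_def)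
  then show "bounded P\<^sub>2" using bounded_\<Omega> by (metis bounded_closure bounded_subset)
  show "bounded (P\<^sub>1 \<inter> P\<^sub>2)" using * bounded_\<Omega> by (auto simp: overlapping_patches_def intro: bounded_subset)
qed

lemma derivative_\<zeta>:
  "\<exists>G. continuous_on (cbox 0 m) G \<and>
     (\<forall>s\<in>cbox 0 m. (\<zeta> has_derivative (\<lambda>v. G s \<bullet> v)) (at s within cbox 0 m))"
  using overlap by (simp add: graph_overlap_def C1_rectangle_def)

lemma continuous_\<zeta>: "continuous_on (cbox 0 m) \<zeta>"
proof -
  obtain G where G: "continuous_on (cbox 0 m) G \<and>
      (\<forall>s\<in>cbox 0 m. (\<zeta> has_derivative (\<lambda>v. G s \<bullet> v)) (at s within cbox 0 m))"
    using derivative_\<zeta> ..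
  show ?thesis by (rule has_derivative_continuous_on[where f' = "\<lambda>s v. G s \<bullet> v"]) (use G in simp)
qed

lemma graph_in_overlap_face:
  assumes "s \<in> box 0 m"
  shows "T (s, \<zeta> s) \<in> frontier P\<^sub>2" "T (s, \<zeta> s) \<in> P\<^sub>1"
  using overlap assms unfolding graph_overlap_def overlap_face_def graph_map_eq_T by blast+

lemma \<zeta>_nonzero:
  assumes s: "s \<in> box 0 m"
  shows "\<zeta> s \<noteq> 0"
proof
  assume "\<zeta> s = 0"
  have "s \<in> cbox 0 m" using s box_subset_cbox by blast
  then have "T (s, 0) \<in> face a E m" by (auto simp: T_def frame_map_def face_def)
  then have "T (s, 0) \<in> frontier P\<^sub>1"
    using interface overlap by (auto simp: interface_def graph_overlap_def)
  then have "T (s, 0) \<notin> P\<^sub>1" using patches(1) by (simp add: frontier_def interior_open)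
  then show False using graph_in_overlap_face(2)[OF s] \<open>\<zeta> s = 0\<close> by simp
qed

lemma box_nonempty: "box 0 m \<noteq> {}"
  using frame by (simp add: planar_frame_def interval_ne_empty_cart)

lemma overlap_region: "T -` (P\<^sub>1 \<inter> P\<^sub>2) = {(s, t). s \<in> box 0 m \<and> t \<in> open_segment 0 (\<zeta> s)}"
proof -
  have "T -` (P\<^sub>1 \<inter> P\<^sub>2) = {(s, t). s \<in> interior (cbox 0 m) \<and> t \<in> open_segment 0 (\<zeta> s)}"
  proof (rule bounded_region_between_graphs)
    have op: "open (P\<^sub>1 \<inter> P\<^sub>2)" using patches(1,2) by (rule open_Int)
    show "open (T -` (P\<^sub>1 \<inter> P\<^sub>2))" using op continuous_T by (rule open_vimage)
    show "bounded (T -` (P\<^sub>1 \<inter> P\<^sub>2))"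
    proof -
      obtain r where "\<forall>y\<in>P\<^sub>1 \<inter> P\<^sub>2. dist (T 0) y \<le> r"
        using patches(4) bounded_any_center[of _ "T 0"] by blast
      then have "dist 0 p \<le> r" if "p \<in> T -` (P\<^sub>1 \<inter> P\<^sub>2)" for p
        using that by (metis dist_T vimageD)
      then have "T -` (P\<^sub>1 \<inter> P\<^sub>2) \<subseteq> cball 0 r" by (metis mem_cball subsetI)
      then show ?thesis by (rule bounded_subset[OF bounded_cball])
    qed
    show "T -` (P\<^sub>1 \<inter> P\<^sub>2) \<noteq> {}"
    proof -
      obtain s where "s \<in> box 0 m" using box_nonempty by blast
      then have "T (s, \<zeta> s) \<in> closure P\<^sub>2" "T (s, \<zeta> s) \<in> P\<^sub>1"
        using graph_in_overlap_face by (auto simp: frontier_def)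
      then have "P\<^sub>1 \<inter> P\<^sub>2 \<noteq> {}" using open_Int_closure_eq_empty[OF patches(1)] by blast
      then show ?thesis using surj_T by (metis all_not_in_conv surjD vimageI)
    qed
    show "frontier (T -` (P\<^sub>1 \<inter> P\<^sub>2)) \<subseteq> {(s, t). s \<in> cbox 0 m \<and> (t = 0 \<or> t = \<zeta> s)}"
    proof -
      have face: "face a E m = (\<lambda>s. T (s, 0)) ` cbox 0 m"
        by (simp add: face_def T_def frame_map_def)
      have graph: "graph_map a E n \<zeta> ` cbox 0 m = (\<lambda>s. T (s, \<zeta> s)) ` cbox 0 m"
        by (simp add: graph_map_eq_T)
      have "compact (face a E m)" "compact (graph_map a E n \<zeta> ` cbox 0 m)"
        unfolding face graph
        by (intro compact_continuous_image continuous_on_compose2[OF continuous_T] continuous_intros continuous_\<zeta>; auto)+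
      then have "closure (overlap_face P\<^sub>1 P\<^sub>2) \<union> closure (overlap_face P\<^sub>2 P\<^sub>1) \<subseteq>
          face a E m \<union> graph_map a E n \<zeta> ` cbox 0 m"
        using overlap unfolding graph_overlap_def by (intro Un_mono closure_minimal compact_imp_closed) auto
      then have sub: "frontier (T -` (P\<^sub>1 \<inter> P\<^sub>2)) \<subseteq> T -` (face a E m \<union> graph_map a E n \<zeta> ` cbox 0 m)"
        using frontier_vimage_subset[OF continuous_T op] patches(5) by blast
      have inj: "T p = T q \<longleftrightarrow> p = q" for p q using dist_T[of p q] by (metis dist_eq_0_iff)
      show ?thesis
      proof
        fix p assume "p \<in> frontier (T -` (P\<^sub>1 \<inter> P\<^sub>2))"
        then have "T p \<in> (\<lambda>s. T (s, 0)) ` cbox 0 m \<union> (\<lambda>s. T (s, \<zeta> s)) ` cbox 0 m"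
          using sub unfolding face graph by blast
        then show "p \<in> {(s, t). s \<in> cbox 0 m \<and> (t = 0 \<or> t = \<zeta> s)}" by (auto simp: inj)
      qed
    qed
    show "connected (interior (cbox 0 m))" by (simp add: convex_connected)
    show "\<zeta> s \<noteq> 0" if "s \<in> interior (cbox 0 m)" for s using \<zeta>_nonzero that by simp
  qed (rule continuous_\<zeta>)
  then show ?thesis by simp
qed

lemma boundary_trace_limit:
  assumes lip: "\<And>x y. closed_segment x y \<subseteq> P\<^sub>2 \<Longrightarrow> \<bar>\<phi> x - \<phi> y\<bar> \<le> L * norm (x - y)" "L \<ge> 0"
    and s: "s \<in> box 0 m"
  shows "((\<lambda>t. \<phi> (T (s, t))) \<longlongrightarrow> boundary_trace P\<^sub>2 \<phi> (T (s, \<zeta> s))) (at (\<zeta> s) within open_segment 0 (\<zeta> s))"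
proof -
  let ?V = "{(s, t). s \<in> box 0 m \<and> t \<in> open_segment 0 (\<zeta> s)}"
  let ?x = "T (s, \<zeta> s)"
  have V: "T p \<in> P\<^sub>1 \<inter> P\<^sub>2 \<longleftrightarrow> p \<in> ?V" for p using overlap_region by blast
  obtain l where l: "((\<lambda>p. \<phi> (T p)) \<longlongrightarrow> l) (at (s, \<zeta> s) within ?V)"
  proof (rule segment_lipschitz_limit_at_graph[of "box 0 m" \<zeta> s "\<lambda>p. \<phi> (T p)" L])
    show "\<bar>\<phi> (T p) - \<phi> (T q)\<bar> \<le> L * norm (p - q)" if "closed_segment p q \<subseteq> ?V" for p q
    proof -
      have "closed_segment (T p) (T q) \<subseteq> P\<^sub>2"
        using that V unfolding T_def closed_segment_frame_map[OF frame] by blast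
      from lip(1)[OF this] show ?thesis using dist_T[of p q] by (simp add: dist_norm)
    qed
  qed (use s \<zeta>_nonzero lip(2) continuous_on_subset[OF continuous_\<zeta> box_subset_cbox] in auto)
  have "(\<phi> \<longlongrightarrow> l) (at ?x within P\<^sub>2)"
    unfolding Lim_within
  proof (intro allI impI)
    fix e :: real assume "e > 0"
    then obtain \<delta> where \<delta>: "\<delta> > 0" "\<And>p. p \<in> ?V \<Longrightarrow> 0 < dist p (s, \<zeta> s) \<Longrightarrow> dist p (s, \<zeta> s) < \<delta> \<Longrightarrow> dist (\<phi> (T p)) l < e"
      using l unfolding Lim_within by blast
    obtain r where r: "r > 0" "ball ?x r \<subseteq> P\<^sub>1"
      using patches(1) graph_in_overlap_face(2)[OF s] open_contains_ball by blast
    have "dist (\<phi> y) l < e" if y: "y \<in> P\<^sub>2" "0 < dist y ?x" "dist y ?x < min \<delta> r" for y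
    proof -
      obtain p where p: "y = T p" using surj_T by (metis surjD)
      have "y \<in> P\<^sub>1" using r y by (auto simp: dist_commute subset_iff)
      then have "p \<in> ?V" using V[of p] y(1) p by blast
      then show ?thesis using \<delta>(2)[of p] y p by (simp add: dist_T)
    qed
    then show "\<exists>d>0. \<forall>y\<in>P\<^sub>2. 0 < dist y ?x \<and> dist y ?x < d \<longrightarrow> dist (\<phi> y) l < e"
      using \<delta>(1) r(1) by (intro exI[of _ "min \<delta> r"]) auto
  qed
  moreover have "at ?x within P\<^sub>2 \<noteq> bot"
  proof -
    have "?x \<in> closure P\<^sub>2" "?x \<notin> P\<^sub>2"
      using graph_in_overlap_face(1)[OF s] patches(2) by (auto simp: frontier_def interior_open)
    then show ?thesis by (simp add: closure_def trivial_limit_within)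
  qed
  ultimately have "boundary_trace P\<^sub>2 \<phi> ?x = l"
    unfolding boundary_trace_def by (intro tendsto_Lim) auto
  moreover have "filterlim (\<lambda>t. (s, t)) (at (s, \<zeta> s) within ?V) (at (\<zeta> s) within open_segment 0 (\<zeta> s))"
    unfolding filterlim_at using s by (auto intro!: tendsto_intros simp: eventually_at_filter)
  from filterlim_compose[OF l this] have "((\<lambda>t. \<phi> (T (s, t))) \<longlongrightarrow> l) (at (\<zeta> s) within open_segment 0 (\<zeta> s))" .
  ultimately show ?thesis by simp
qed

lemma abs_\<zeta>_le_overlap_width:
  assumes "s \<in> cbox 0 m"
  shows "\<bar>\<zeta> s\<bar> \<le> overlap_width a E m n \<zeta>"
proof -
  have eq: "norm ((a + E s) - graph_map a E n \<zeta> s) = \<bar>\<zeta> s\<bar>" for s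
    using frame by (simp add: graph_map_def planar_frame_def)
  have "compact ((\<lambda>s. \<bar>\<zeta> s\<bar>) ` cbox 0 m)"
    by (intro compact_continuous_image continuous_intros continuous_\<zeta>) auto
  then show ?thesis
    unfolding overlap_width_def eq
    using assms by (intro cSUP_upper bounded_imp_bdd_above compact_imp_bounded)
qed

lemma overlap_width_pos: "overlap_width a E m n \<zeta> > 0"
proof -
  obtain s where s: "s \<in> box 0 m" using box_nonempty by blast
  then have "s \<in> cbox 0 m" using box_subset_cbox by blast
  then show ?thesis using abs_\<zeta>_le_overlap_width[of s] \<zeta>_nonzero[OF s] by simp
qed

lemma nn_integral_trace_le:
  fixes \<phi> :: "real^'n \<Rightarrow> real" and \<gamma> :: "real^'m \<Rightarrow> real"
  defines "\<gamma> \<equiv> \<lambda>s. boundary_trace P\<^sub>2 \<phi> (T (s, \<zeta> s))"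
  assumes bound: "\<And>s. s \<in> box 0 m \<Longrightarrow> \<bar>\<gamma> s\<bar> \<le> B"
    and meas: "(\<lambda>s. indicator (box 0 m) s * \<gamma> s) \<in> borel_measurable borel"
  shows "(\<integral>\<^sup>+s. ennreal ((\<gamma> s)\<^sup>2) * indicator (box 0 m) s \<partial>lborel) \<le>
    ennreal (graph_surface_integral a E m n \<zeta> (overlap_face P\<^sub>2 P\<^sub>1) (\<lambda>x. (boundary_trace P\<^sub>2 \<phi> x)\<^sup>2))"
proof -
  define A where "A = {s \<in> cbox 0 m. graph_map a E n \<zeta> s \<in> overlap_face P\<^sub>2 P\<^sub>1}"
  have A: "box 0 m \<subseteq> A" "A \<subseteq> cbox 0 m"
    using overlap box_subset_cbox unfolding graph_overlap_def A_def by blast+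
  obtain G where "continuous_on (cbox 0 m) G \<and>
      (\<forall>s\<in>cbox 0 m. (\<zeta> has_derivative (\<lambda>v. G s \<bullet> v)) (at s within cbox 0 m))"
    using derivative_\<zeta> ..
  then have G: "continuous_on (cbox 0 m) G"
    "\<And>s. s \<in> cbox 0 m \<Longrightarrow> (\<zeta> has_derivative (\<lambda>v. G s \<bullet> v)) (at s within cbox 0 m)"
    by simp_all
  have grad: "grad \<zeta> s = G s" if s: "s \<in> box 0 m" for s
  proof (rule grad_eq)
    have "at s within cbox 0 m = at s" using s by (intro at_within_interior) simp
    then show "GDERIV \<zeta> s :> G s"
      using G(2)[of s] s box_subset_cbox unfolding gderiv_def by (auto simp: inner_commute)
  qed
  obtain M where M: "\<And>s. s \<in> cbox 0 m \<Longrightarrow> norm (G s) \<le> M"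
    using compact_imp_bounded[OF compact_continuous_image[OF G(1) compact_cbox]] by (auto simp: bounded_iff)
  define f where "f s = indicator A s *\<^sub>R ((\<gamma> s)\<^sup>2 * sqrt (1 + (norm (grad \<zeta> s))\<^sup>2))" for s
  define g where "g s = (indicator (box 0 m) s * \<gamma> s)\<^sup>2 * sqrt (1 + (norm (indicator (box 0 m) s *\<^sub>R G s))\<^sup>2)" for s
  have Gm: "(\<lambda>s. indicator (box 0 m) s *\<^sub>R G s) \<in> borel_measurable borel"
    using G(1) by (intro borel_measurable_continuous_on_indicator continuous_on_subset[OF G(1) box_subset_cbox]) auto
  have "(\<integral>\<^sup>+s. ennreal ((\<gamma> s)\<^sup>2) * indicator (box 0 m) s \<partial>lborel) \<le> (\<integral>\<^sup>+s. ennreal (f s) \<partial>lborel)"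
  proof (rule nn_integral_mono)
    fix s
    have "(\<gamma> s)\<^sup>2 * 1 \<le> (\<gamma> s)\<^sup>2 * sqrt (1 + (norm (grad \<zeta> s))\<^sup>2)" by (intro mult_left_mono) auto
    then show "ennreal ((\<gamma> s)\<^sup>2) * indicator (box 0 m) s \<le> ennreal (f s)"
      using A(1) by (auto simp: f_def indicator_def ennreal_leI)
  qed
  also have "\<dots> = ennreal (\<integral>s. f s \<partial>lebesgue)"
  proof (rule nn_integral_eq_lebesgue_integral[where N = "cbox 0 m - box 0 m" and S = "cbox 0 m" and B = "B\<^sup>2 * sqrt (1 + M\<^sup>2)"])
    show "g \<in> borel_measurable borel"
      unfolding g_def[abs_def]
      by (rule borel_measurable_times[OF borel_measurable_power[OF meas]]) (use Gm in measurable)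
    show "f s = g s" if "s \<notin> cbox 0 m - box 0 m" for s
      using that A grad[of s] by (cases "s \<in> box 0 m") (auto simp: f_def g_def subset_iff indicator_def)
    show "f s \<le> B\<^sup>2 * sqrt (1 + M\<^sup>2)" if "s \<notin> cbox 0 m - box 0 m" "s \<in> cbox 0 m" for s
    proof -
      have s: "s \<in> box 0 m" using that by blast
      have "\<bar>\<gamma> s\<bar>\<^sup>2 \<le> B\<^sup>2" "norm (G s) ^ 2 \<le> M\<^sup>2"
        using bound[OF s] M[OF that(2)] by (intro power_mono; simp)+
      then show ?thesis
        using A s by (auto simp: f_def grad[OF s] subset_iff intro!: mult_mono)
    qed
    show "f s \<ge> 0" for s by (simp add: f_def)
    show "f s = 0" if "s \<notin> cbox 0 m" for s using that A by (auto simp: f_def indicator_def)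
  qed (auto intro: negligible_frontier_interval)
  also have "(\<integral>s. f s \<partial>lebesgue) =
      graph_surface_integral a E m n \<zeta> (overlap_face P\<^sub>2 P\<^sub>1) (\<lambda>x. (boundary_trace P\<^sub>2 \<phi> x)\<^sup>2)"
    unfolding graph_surface_integral_def set_lebesgue_integral_def f_def A_def \<gamma>_def graph_map_eq_T ..
  finally show ?thesis .
qed

end

subsection \<open>The estimate\<close>

theorem proposition1:
  fixes \<Omega> \<Omega>\<^sub>1 \<Omega>\<^sub>2 :: "(real^'n) set"
    and a n :: "real^'n" and E :: "real^'m \<Rightarrow> real^'n" and m :: "real^'m"
    and \<rho>\<^sub>1 \<rho>\<^sub>2 C lam :: real and p :: nat
  assumes "CARD('n) \<in> {2, 3}" and "CARD('n) = CARD('m) + 1"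
    and "lipschitz_domain \<Omega>"
    and "subdomain_decomposition \<Omega> \<Omega>\<^sub>1 \<Omega>\<^sub>2"
    and "planar_frame E m n"
    and "interface \<Omega>\<^sub>1 \<Omega>\<^sub>2 = face a E m"
    and "exterior_direction \<Omega>\<^sub>1 (face a E m) n"
    and "\<rho>\<^sub>1 > 0" and "\<rho>\<^sub>2 > 0"
    and "C > 0" and "lam \<ge> 1"
  shows "\<exists>c>0. \<forall>P\<^sub>1 P\<^sub>2 \<zeta> \<Xi>\<^sub>1 \<Xi>\<^sub>2 \<Phi>\<^sub>2 \<phi>.
    graph_overlap \<Omega> \<Omega>\<^sub>1 a E m n P\<^sub>1 P\<^sub>2 \<zeta> \<longrightarrow>
    (\<forall>i. open_knot_vector p (\<Xi>\<^sub>1 i)) \<longrightarrow>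
    (\<forall>i. open_knot_vector p (\<Xi>\<^sub>2 i)) \<longrightarrow>
    bspline_parametrization \<Phi>\<^sub>2 P\<^sub>2 \<longrightarrow>
    \<phi> \<in> mapped_bspline_space \<Xi>\<^sub>2 p \<Phi>\<^sub>2 \<longrightarrow>
    (let h = mesh_size \<Xi>\<^sub>1 \<Xi>\<^sub>2;
         d\<^sub>o = overlap_width a E m n \<zeta>;
         F\<^sub>o\<^sub>2\<^sub>1 = overlap_face P\<^sub>2 P\<^sub>1;
         \<rho>\<^sub>a\<^sub>v\<^sub>g = (\<rho>\<^sub>1 + \<rho>\<^sub>2) / 2
     in d\<^sub>o \<le> C * h powr lam \<longrightarrow>
        (L2_norm (P\<^sub>1 \<inter> P\<^sub>2) \<phi>)\<^sup>2 \<le>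
          c * d\<^sub>o * h *
            ((LINT x : P\<^sub>2 | lebesgue. (norm (grad \<phi> x))\<^sup>2) +
             \<rho>\<^sub>a\<^sub>v\<^sub>g / h * graph_surface_integral a E m n \<zeta> F\<^sub>o\<^sub>2\<^sub>1
                          (\<lambda>x. (boundary_trace P\<^sub>2 \<phi> x)\<^sup>2)))"
proof -
  obtain \<kappa> :: real where \<kappa>: "\<kappa> > 0"
    "\<And>a F. F \<in> borel_measurable borel \<Longrightarrow>
       (\<integral>\<^sup>+y. F y \<partial>lborel) = ennreal \<kappa> * (\<integral>\<^sup>+p. F (a + frame_map E n p) \<partial>lborel)"
    using nn_integral_linear_isometry[OF linear_frame_map[OF assms(5)] norm_frame_map[OF assms(5)]
        surj_frame_map[OF assms(5,2)]] by blast
  define K where "K = C * diameter (cbox 0 1 :: (real^'n) set) powr (lam - 1)"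
  define c where "c = 2 * K + 4 * \<kappa> / (\<rho>\<^sub>1 + \<rho>\<^sub>2)"
  have "K \<ge> 0" using assms(10) by (simp add: K_def)
  then have "c > 0" using \<kappa>(1) assms(8,9) by (simp add: c_def add_nonneg_pos)
  have "(L2_norm (P\<^sub>1 \<inter> P\<^sub>2) \<phi>)\<^sup>2 \<le> c * d\<^sub>o * h *
      ((LINT x : P\<^sub>2 | lebesgue. (norm (grad \<phi> x))\<^sup>2) +
       (\<rho>\<^sub>1 + \<rho>\<^sub>2) / 2 / h * graph_surface_integral a E m n \<zeta> (overlap_face P\<^sub>2 P\<^sub>1) (\<lambda>x. (boundary_trace P\<^sub>2 \<phi> x)\<^sup>2))"
    if overlap: "graph_overlap \<Omega> \<Omega>\<^sub>1 a E m n P\<^sub>1 P\<^sub>2 \<zeta>"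
      and knots: "\<forall>i. open_knot_vector p (\<Xi>\<^sub>1 i)" "\<forall>i. open_knot_vector p (\<Xi>\<^sub>2 i)"
      and \<Phi>: "bspline_parametrization \<Phi>\<^sub>2 P\<^sub>2" and \<phi>: "\<phi> \<in> mapped_bspline_space \<Xi>\<^sub>2 p \<Phi>\<^sub>2"
      and h: "h = mesh_size \<Xi>\<^sub>1 \<Xi>\<^sub>2" and d: "d\<^sub>o = overlap_width a E m n \<zeta>" and dh: "d\<^sub>o \<le> C * h powr lam"
    for P\<^sub>1 P\<^sub>2 \<zeta> \<Xi>\<^sub>1 \<Xi>\<^sub>2 \<Phi>\<^sub>2 \<phi> h d\<^sub>o
  proof -
    interpret graph_overlap_patches \<Omega> \<Omega>\<^sub>1 \<Omega>\<^sub>2 P\<^sub>1 P\<^sub>2 a n E m \<zeta>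
      using assms(2,3,5,6) overlap by unfold_locales (auto simp: lipschitz_domain_def)
    obtain L N where L: "L \<ge> 0" "bounded (\<phi> ` P\<^sub>2)"
      "\<And>x y. closed_segment x y \<subseteq> P\<^sub>2 \<Longrightarrow> \<bar>\<phi> x - \<phi> y\<bar> \<le> L * norm (x - y)"
      "negligible N" "\<And>x. x \<in> P\<^sub>2 - N \<Longrightarrow> \<phi> differentiable at x"
      using mapped_bspline_regularity[of p \<Xi>\<^sub>2, OF _ \<Phi> \<phi>] knots(2) by metis
    obtain B where B: "\<And>x. x \<in> P\<^sub>2 \<Longrightarrow> \<bar>\<phi> x\<bar> \<le> B" using L(2) by (auto simp: bounded_iff)
    interpret segment_lipschitz P\<^sub>2 \<phi> L B N
      using patches L B by unfold_locales auto
    define \<gamma> where "\<gamma> = (\<lambda>s. boundary_trace P\<^sub>2 \<phi> (T (s, \<zeta> s)))"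
    define D where "D = (LINT x : P\<^sub>2 | lebesgue. (norm (grad \<phi> x))\<^sup>2)"
    define S where "S = graph_surface_integral a E m n \<zeta> (overlap_face P\<^sub>2 P\<^sub>1) (\<lambda>x. (boundary_trace P\<^sub>2 \<phi> x)\<^sup>2)"
    have open_W: "open (P\<^sub>1 \<inter> P\<^sub>2)" using patches(1,2) by (rule open_Int)
    note region = overlap_region[unfolded T_eq]
    have trace: "((\<lambda>t. \<phi> (a + frame_map E n (s, t))) \<longlongrightarrow> \<gamma> s) (at (\<zeta> s) within open_segment 0 (\<zeta> s))"
      if "s \<in> box 0 m" for s
      using boundary_trace_limit[OF L(3,1) that] by (simp add: T_def \<gamma>_def)
    note setting = frame open_W Int_lower2 region continuous_\<zeta> \<zeta>_nonzero trace
    have d_pos: "d\<^sub>o > 0" using overlap_width_pos d by simp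
    have "D \<ge> 0" "S \<ge> 0"
      unfolding D_def S_def graph_surface_integral_def set_lebesgue_integral_def
      by (intro Bochner_Integration.integral_nonneg; simp)+
    have "(L2_norm (P\<^sub>1 \<inter> P\<^sub>2) \<phi>)\<^sup>2 = (\<integral>x. indicator (P\<^sub>1 \<inter> P\<^sub>2) x *\<^sub>R (\<phi> x)\<^sup>2 \<partial>lebesgue)"
      unfolding L2_norm_def set_lebesgue_integral_def by (intro real_sqrt_pow2 Bochner_Integration.integral_nonneg) simp
    then have "ennreal ((L2_norm (P\<^sub>1 \<inter> P\<^sub>2) \<phi>)\<^sup>2) \<le> (\<integral>\<^sup>+x. ennreal (indicator (P\<^sub>1 \<inter> P\<^sub>2) x *\<^sub>R (\<phi> x)\<^sup>2) \<partial>lborel)"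
      using lebesgue_integral_le_nn_integral[of "\<lambda>x. indicator (P\<^sub>1 \<inter> P\<^sub>2) x *\<^sub>R (\<phi> x)\<^sup>2"] by simp
    also have "\<dots> = (\<integral>\<^sup>+x. ennreal ((\<phi> x)\<^sup>2) * indicator (P\<^sub>1 \<inter> P\<^sub>2) x \<partial>lborel)"
      by (intro nn_integral_cong) (auto simp: indicator_def)
    also have "\<dots> \<le> ennreal (2 * d\<^sub>o * \<kappa>) * (\<integral>\<^sup>+s. ennreal ((\<gamma> s)\<^sup>2) * indicator (box 0 m) s \<partial>lborel) +
        ennreal (2 * d\<^sub>o\<^sup>2) * (\<integral>\<^sup>+x. ennreal ((norm (grad \<phi> x))\<^sup>2) * indicator P\<^sub>2 x \<partial>lborel)"
    proof (rule region_estimate[OF setting])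
      show "\<bar>\<zeta> s\<bar> \<le> d\<^sub>o" if "s \<in> box 0 m" for s
        using abs_\<zeta>_le_overlap_width[of s] that box_subset_cbox d by blast
    qed (use \<kappa> d_pos in auto)
    also have "\<dots> \<le> ennreal (2 * d\<^sub>o * \<kappa>) * ennreal S + ennreal (2 * d\<^sub>o\<^sup>2) * ennreal D"
      unfolding nn_integral_grad_square D_def[symmetric]
      using nn_integral_trace_le[of \<phi> B] trace_bound[OF setting] trace_measurable[OF setting]
      unfolding \<gamma>_def S_def by (intro add_right_mono mult_left_mono) auto
    also have "\<dots> = ennreal (2 * d\<^sub>o * \<kappa> * S + 2 * d\<^sub>o\<^sup>2 * D)"
      using d_pos \<kappa>(1) \<open>D \<ge> 0\<close> \<open>S \<ge> 0\<close> by (simp add: ennreal_mult)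
    finally have est: "(L2_norm (P\<^sub>1 \<inter> P\<^sub>2) \<phi>)\<^sup>2 \<le> 2 * d\<^sub>o * \<kappa> * S + 2 * d\<^sub>o\<^sup>2 * D"
      using d_pos \<kappa>(1) \<open>D \<ge> 0\<close> \<open>S \<ge> 0\<close> by (subst (asm) ennreal_le_iff) auto
    have h_bounds: "0 \<le> h" "h \<le> diameter (cbox 0 1 :: (real^'n) set)"
      using mesh_size_bounds[of p \<Xi>\<^sub>1 \<Xi>\<^sub>2] knots h by auto
    have "h \<noteq> 0" using d_pos dh by auto
    then have "h > 0" using h_bounds by simp
    have "d\<^sub>o \<le> C * (h powr (lam - 1) * h)"
      using dh \<open>h > 0\<close> powr_add[of h "lam - 1" 1] by simp
    also have "\<dots> \<le> C * (diameter (cbox 0 1 :: (real^'n) set) powr (lam - 1) * h)"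
      using h_bounds assms(10,11) by (intro mult_left_mono mult_right_mono powr_mono2) auto
    finally have dK: "d\<^sub>o \<le> K * h" by (simp add: K_def mult.assoc)
    define \<rho> where "\<rho> = \<rho>\<^sub>1 + \<rho>\<^sub>2"
    have "\<rho> > 0" using assms(8,9) by (simp add: \<rho>_def)
    have "2 * d\<^sub>o\<^sup>2 * D \<le> 2 * (d\<^sub>o * (K * h)) * D"
      using dK d_pos \<open>D \<ge> 0\<close> by (intro mult_right_mono) (auto simp: power2_eq_square)
    also have "\<dots> = 2 * K * (d\<^sub>o * h * D)" by simp
    also have "\<dots> \<le> c * (d\<^sub>o * h * D)"
      using \<kappa>(1) \<open>\<rho> > 0\<close> d_pos \<open>h > 0\<close> \<open>D \<ge> 0\<close> by (intro mult_right_mono) (auto simp: c_def \<rho>_def)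
    finally have 1: "2 * d\<^sub>o\<^sup>2 * D \<le> c * (d\<^sub>o * h * D)" .
    have "2 * d\<^sub>o * \<kappa> * S = (4 * \<kappa> / \<rho>) * (d\<^sub>o * (\<rho> / 2) * S)"
      using \<open>\<rho> > 0\<close> by simp
    also have "\<dots> \<le> c * (d\<^sub>o * (\<rho> / 2) * S)"
      using \<open>K \<ge> 0\<close> \<open>\<rho> > 0\<close> d_pos \<open>S \<ge> 0\<close> by (intro mult_right_mono) (auto simp: c_def \<rho>_def)
    finally have 2: "2 * d\<^sub>o * \<kappa> * S \<le> c * (d\<^sub>o * (\<rho> / 2) * S)" .
    have "(L2_norm (P\<^sub>1 \<inter> P\<^sub>2) \<phi>)\<^sup>2 \<le> c * (d\<^sub>o * (\<rho> / 2) * S) + c * (d\<^sub>o * h * D)"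
      using est 1 2 by linarith
    also have "\<dots> = c * d\<^sub>o * h * (D + \<rho> / 2 / h * S)"
      using \<open>h > 0\<close> by (simp add: field_simps)
    finally show ?thesis unfolding D_def S_def \<rho>_def .
  qed
  then show ?thesis using \<open>c > 0\<close> unfolding Let_def by blast
qed

end
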